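(* Let $\Gamma$ be a finite two-player game with partial monitoring, with finite families $(x_\ell)_{\ell\in\mathcal{L}}$, $(y_k)_{k\in\mathcal{K}}$ of mixed actions and families of polytopes $\{Y_\ell;\ \ell\in\mathcal{L}\}$, $\{X_k;\ k\in\mathcal{K}\}$ as in the context, and let $$\mathbf{Y}_\ell=\Big\{\mathbf{y}\in\Delta(\mathcal{K}):\ \sum_{k\in\mathcal{K}}\mathbf{y}[k]y_k\in Y_\ell\Big\},\qquad \mathbf{X}_k=\Big\{\mathbf{x}\in\Delta(\mathcal{L}):\ \sum_{\ell\in\mathcal{L}}\mathbf{x}[\ell]x_\ell\in X_k\Big\}.$$ If $\{\mathbf{Y}_\ell;\ \ell\in\mathcal{L}\}$ and $\{\mathbf{X}_k;\ k\in\mathcal{K}\}$ satisfy the genericity assumption (G) of the context, then there is an odd number of fully labelled points in $\Delta(\mathcal{L})\times\Delta(\mathcal{K})$, and each of them, $(\mathbf{x},\mathbf{y})$, induces a Nash equilibrium $\left(\sum_{\ell}\mathbf{x}[\ell]x_\ell,\ \sum_{k}\mathbf{y}[k]y_k\right)$ of $\Gamma$.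
   Context: Game with partial monitoring: $\mathcal{A},\mathcal{B}$ are the finite action sets of players 1 and 2, of cardinalities $A$ and $B$; $\mathcal{X}=\Delta(\mathcal{A})$, $\mathcal{Y}=\Delta(\mathcal{B})$ are the sets of mixed actions (probability vectors); $u,v:\mathcal{A}\times\mathcal{B}\to\mathbb{R}$ are the payoffs of players 1 and 2, extended multilinearly to $\mathcal{X}\times\mathcal{Y}$. There are convex compact sets of messages $\mathcal{H},\mathcal{M}$ (in real vector spaces) and signaling maps $H:\mathcal{A}\times\mathcal{B}\to\mathcal{H}$, $M:\mathcal{A}\times\mathcal{B}\to\mathcal{M}$, also extended multilinearly. Put $\mathbf{H}(y)=[H(a,y)]_{a\in\mathcal{A}}$ for $y\in\mathcal{Y}$, $\mathbf{M}(x)=[M(x,b)]_{b\in\mathcal{B}}$ for $x\in\mathcal{X}$, and $$\Phi(y)=\{u(\cdot,y')\in\mathbb{R}^A:\ y'\in\mathcal{Y},\ \mathbf{H}(y')=\mathbf{H}(y)\},\qquad \Psi(x)=\{v(x',\cdot)\in\mathbb{R}^B:\ x'\in\mathcal{X},\ \mathbf{M}(x')=\mathbf{M}(x)\}.$$ Nash equilibrium of $\Gamma$: a pair $(x^*,y^* )\in\mathcal{X}\times\mathcal{Y}$ with $x^*\in\arg\max_{x\in\mathcal{X}}\inf_{U\in\Phi(y^* )}\langle x,U\rangle$ and $y^*\in\arg\max_{y\in\mathcal{Y}}\inf_{V\in\Psi(x^* )}\langle y,V\rangle$. Families of mixed actions. $(x_\ell)_{\ell\in\mathcal{L}}$ is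 a finite family in $\mathcal{X}$ (repetitions allowed) such that for every $y\in\mathcal{Y}$ some $x_\ell$ maximizes $x\mapsto\min_{U\in\Phi(y)}\langle x,U\rangle$ over $\mathcal{X}$, and every maximizer is a convex combination of those $x_\ell$ that are maximizers for $y$. For each mixed action $z$ occurring in the family, the best-reply area $\{y\in\mathcal{Y}:\ z \text{ maximizes } \min_{U\in\Phi(y)}\langle \cdot,U\rangle \text{ over }\mathcal{X}\}$ is a finite union of polytopes; it is subdivided into finitely many polytopes, $z$ being duplicated accordingly, so that it equals $\bigcup_{\ell:\,x_\ell=z}Y_\ell$ with each $Y_\ell$ a polytope. In particular $x_\ell$ is a maximizer for every $y\in Y_\ell$. Symmetrically for player 2: $(y_k)_{k\in\mathcal{K}}$ in $\mathcal{Y}$, and polytopes $X_k\subset\mathcal{X}$ on which $y_k$ maximizes $\min_{V\in\Psi(x)}\langle\cdot,V\rangle$ over $\mathcal{Y}$. Assumption (G). $\{\mathbf{Y}_\ell;\ \ell\in\mathcal{L}\}$ is a polytopial complex of $\Delta(\mathcal{K})$, i.e. each $\mathbf{Y}_\ell$ is a polytope with non-empty interior, their union is $\Delta(\mathcal{K})$, and $\mathbf{Y}_\ell\cap\mathbf{Y}_{\ell'}$ has empty interior for $\ell\neq\ell'$ (interiors relative to the affine hull of $\Delta(\mathcal{K})$); and every $\mathbf{y}\in\Delta(\mathcal{K})$ belongs to at most $m_{\mathbf{y}}$ of the sets $\mathbf{Y}_\ell$, where $m_{\mathbf{y}}$ is the size of the support of $\mathbf{y}$. The same holds for $\{\mathbf{X}_k;\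 k\in\mathcal{K}\}$ in $\Delta(\mathcal{L})$. Fully labelled: $(\mathbf{x},\mathbf{y})\in\Delta(\mathcal{L})\times\Delta(\mathcal{K})$ is fully labelled if for every $\ell\in\mathcal{L}$ either $\mathbf{x}[\ell]=0$ or $\mathbf{y}\in\mathbf{Y}_\ell$, and for every $k\in\mathcal{K}$ either $\mathbf{y}[k]=0$ or $\mathbf{x}\in\mathbf{X}_k$. *)

theory Defs
  imports "HOL-Analysis.Analysis"
begin

text \<open>
  Action sets and index sets are finite types, so mixed actions are vectors in
  \<^typ>\<open>real ^ 'n\<close>. Everything below is phrased from the point of view of one player, who
  chooses the first argument of the payoff map and of the signaling map. The notions for player 2
  are obtained by exchanging the arguments of both maps: \<open>\<lambda>b a. v a b\<close> and \<open>\<lambda>b a. M a b\<close>.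
\<close>

definition prob_simplex :: "(real ^ 'n) set" where
  "prob_simplex = {p. (\<forall>i. 0 \<le> p $ i) \<and> (\<Sum>i\<in>UNIV. p $ i) = 1}"

definition payoff_vector :: "('a \<Rightarrow> 'b \<Rightarrow> real) \<Rightarrow> real ^ 'b \<Rightarrow> real ^ 'a" where
  "payoff_vector u y = (\<chi> a. \<Sum>b\<in>UNIV. y $ b * u a b)"

definition flag :: "('a \<Rightarrow> 'b \<Rightarrow> 'h::real_vector) \<Rightarrow> real ^ 'b \<Rightarrow> 'a \<Rightarrow> 'h" where
  "flag H y = (\<lambda>a. \<Sum>b\<in>UNIV. (y $ b) *\<^sub>R H a b)"

text \<open>The set \<open>\<Phi>(y)\<close>; with exchanged arguments, \<open>\<Psi>(x)\<close>.\<close>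

definition compatible_payoffs ::
    "('a \<Rightarrow> 'b \<Rightarrow> real) \<Rightarrow> ('a \<Rightarrow> 'b \<Rightarrow> 'h::real_vector) \<Rightarrow> real ^ 'b \<Rightarrow> (real ^ 'a) set" where
  "compatible_payoffs u H y = {payoff_vector u y' |y'. y' \<in> prob_simplex \<and> flag H y' = flag H y}"

text \<open>
  The infimum is one of real numbers. For \<open>y\<close> in the simplex it ranges over a non-empty compact
  set, hence it is a minimum.
\<close>

definition worst_payoff ::
    "('a \<Rightarrow> 'b \<Rightarrow> real) \<Rightarrow> ('a \<Rightarrow> 'b \<Rightarrow> 'h::real_vector) \<Rightarrow> real ^ 'b \<Rightarrow> real ^ 'a \<Rightarrow> real" where
  "worst_payoff u H y x = (INF U\<in>compatible_payoffs u H y. x \<bullet> U)"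

definition best_replies ::
    "('a \<Rightarrow> 'b \<Rightarrow> real) \<Rightarrow> ('a \<Rightarrow> 'b \<Rightarrow> 'h::real_vector) \<Rightarrow> real ^ 'b \<Rightarrow> (real ^ 'a) set" where
  "best_replies u H y = {x. is_arg_max (worst_payoff u H y) (\<lambda>x'. x' \<in> prob_simplex) x}"

definition nash_equilibrium ::
    "('a \<Rightarrow> 'b \<Rightarrow> real) \<Rightarrow> ('a \<Rightarrow> 'b \<Rightarrow> real) \<Rightarrow> ('a \<Rightarrow> 'b \<Rightarrow> 'h::real_vector) \<Rightarrow>
     ('a \<Rightarrow> 'b \<Rightarrow> 'm::real_vector) \<Rightarrow> real ^ 'a \<Rightarrow> real ^ 'b \<Rightarrow> bool" where
  "nash_equilibrium u v H M x y \<longleftrightarrow>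
     x \<in> prob_simplex \<and> y \<in> prob_simplex \<and>
     x \<in> best_replies u H y \<and> y \<in> best_replies (\<lambda>b a. v a b) (\<lambda>b a. M a b) x"

text \<open>
  The conditions on a family \<open>(x\<^sub>\<ell>)\<close> of mixed actions and its polytopes \<open>(Y\<^sub>\<ell>)\<close>. The family may
  have repetitions: the best-reply area of a mixed action \<open>z\<close> is the union of the polytopes of all
  indices at which \<open>z\<close> occurs.
\<close>

definition best_reply_family ::
    "('a \<Rightarrow> 'b \<Rightarrow> real) \<Rightarrow> ('a \<Rightarrow> 'b \<Rightarrow> 'h::real_vector) \<Rightarrow>
     ('l::finite \<Rightarrow> real ^ 'a) \<Rightarrow> ('l \<Rightarrow> (real ^ 'b) set) \<Rightarrow> bool" where
  "best_reply_family u H xs Y \<longleftrightarrow>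
     (\<forall>l. xs l \<in> prob_simplex) \<and>
     (\<forall>y\<in>prob_simplex. \<exists>l. xs l \<in> best_replies u H y) \<and>
     (\<forall>y\<in>prob_simplex.
        best_replies u H y \<subseteq> convex hull {xs l |l. xs l \<in> best_replies u H y}) \<and>
     (\<forall>l. polytope (Y l)) \<and>
     (\<forall>z\<in>range xs. {y \<in> prob_simplex. z \<in> best_replies u H y} = (\<Union>l\<in>{l. xs l = z}. Y l))"

definition induced_action :: "('k::finite \<Rightarrow> real ^ 'b) \<Rightarrow> real ^ 'k \<Rightarrow> real ^ 'b" where
  "induced_action ys p = (\<Sum>k\<in>UNIV. (p $ k) *\<^sub>R ys k)"

text \<open>The sets \<open>\<^bold>Y\<^sub>\<ell>\<close> and, with the roles of the players exchanged, \<open>\<^bold>X\<^sub>k\<close>.\<close>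

definition lifted_area ::
    "('k::finite \<Rightarrow> real ^ 'b) \<Rightarrow> ('l \<Rightarrow> (real ^ 'b) set) \<Rightarrow> 'l \<Rightarrow> (real ^ 'k) set" where
  "lifted_area ys Y l = {p \<in> prob_simplex. induced_action ys p \<in> Y l}"

definition simplex_interior :: "(real ^ 'k) set \<Rightarrow> (real ^ 'k) set" where
  "simplex_interior S =
     top_of_set (affine hull (prob_simplex :: (real ^ 'k) set)) interior_of S"

definition polytopial_complex :: "('l::finite \<Rightarrow> (real ^ 'k) set) \<Rightarrow> bool" where
  "polytopial_complex C \<longleftrightarrow>
     (\<forall>l. polytope (C l) \<and> simplex_interior (C l) \<noteq> {}) \<and>
     (\<Union>l. C l) = prob_simplex \<and>
     (\<forall>l l'. l \<noteq> l' \<longrightarrow> simplex_interior (C l \<inter> C l') = {})"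

definition generic_complex :: "('l::finite \<Rightarrow> (real ^ 'k) set) \<Rightarrow> bool" where
  "generic_complex C \<longleftrightarrow>
     polytopial_complex C \<and>
     (\<forall>p\<in>prob_simplex. card {l. p \<in> C l} \<le> card {k. p $ k \<noteq> 0})"

definition fully_labelled ::
    "('l::finite \<Rightarrow> (real ^ 'k::finite) set) \<Rightarrow> ('k \<Rightarrow> (real ^ 'l) set) \<Rightarrow>
     real ^ 'l \<Rightarrow> real ^ 'k \<Rightarrow> bool" where
  "fully_labelled CY CX p q \<longleftrightarrow>
     p \<in> prob_simplex \<and> q \<in> prob_simplex \<and>
     (\<forall>l. p $ l = 0 \<or> q \<in> CY l) \<and> (\<forall>k. q $ k = 0 \<or> p \<in> CX k)"

end

theory Submission
  imports Defs
begin

text \<open>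
  Enlarge the cones over the sets \<open>\<^bold>Y\<^sub>\<ell>\<close> by one cone for each coordinate \<open>k\<close>, outside the positive
  orthant, to a tiling of \<open>\<real>\<^sup>K\<close> by convex cones. Genericity says that every nonzero point lies in at most
  \<open>|K|\<close> of these cones. The points in exactly \<open>|K|\<close> of them form finitely many rays, the vertices; any
  \<open>|K| - 1\<close> of the cones have either no or exactly two vertices in common. A vertex in
  \<open>\<Delta>(K)\<close> is given by its support \<open>S\<close> and its set of labels \<open>T\<close>, where \<open>|S| = |T|\<close>, and one more vertex,
  outside the simplex, corresponds to \<open>({}, {})\<close>. So the vertices for the two players are the matrices
  modulo 2 of two cochain maps between the augmented cochain complexes of the full simplices on
  \<open>L\<close> and \<open>K\<close>. A fully labelled point is a pair of vertices whose supports and labels match, so these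
  points, together with the artificial pair at \<open>({}, {})\<close>, are counted by the trace of the composed
  map. This trace is even because the augmented complex is contractible.
\<close>

section \<open>Tilings by convex cones\<close>

text \<open>Think of \<open>a i j\<close> as a normal of a hyperplane separating cell
  \<open>i\<close> from cell \<open>j\<close>, with \<open>i\<close> on the nonnegative side. Cells
  are defined by these normals alone, so restricting the index set \<open>I\<close> can describe the
  local picture at a point.\<close>

locale separating_vectors =
  fixes a :: "'i \<Rightarrow> 'i \<Rightarrow> 'v::euclidean_space"
  assumes antisym: "a i j = - a j i"
begin

definition cells :: "'i set \<Rightarrow> 'v \<Rightarrow> 'i set" where
  "cells I z = {i \<in> I. \<forall>j\<in>I. 0 \<le> a i j \<bullet> z}"

text \<open>The intersection of all cells of \<open>I\<close>: by antisymmetry the inequalities hold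
  there as equations, so it is a subspace, and translation along it preserves every cell.\<close>

definition lineality :: "'i set \<Rightarrow> 'v set" where
  "lineality I = {z. \<forall>i\<in>I. \<forall>j\<in>I. a i j \<bullet> z = 0}"

text \<open>The last condition gives every cell a point strictly inside it, which by antisymmetry
  lies in no other cell.\<close>

definition tiling :: "'i set \<Rightarrow> bool" where
  "tiling I \<longleftrightarrow> finite I \<and> (\<forall>z. cells I z \<noteq> {}) \<and> (\<forall>i\<in>I. \<exists>z. \<forall>j\<in>I - {i}. 0 < a i j \<bullet> z)"

lemma cells_subset: "cells I z \<subseteq> I"
  by (auto simp: cells_def)

lemma
  assumes "tiling I"
  shows tiling_finite: "finite I"
    and tiling_cover: "cells I z \<noteq> {}"
  using assms by (simp_all add: tiling_def)

lemma tiling_strict: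
  assumes "tiling I" "i \<in> I"
  obtains s where "\<forall>j\<in>I - {i}. 0 < a i j \<bullet> s"
  using assms unfolding tiling_def by metis

lemma finite_cells: "tiling I \<Longrightarrow> finite (cells I z)"
  by (rule finite_subset[OF cells_subset tiling_finite])

lemma inner_antisym: "a i j \<bullet> z = - (a j i \<bullet> z)"
  by (metis antisym inner_minus_left)

lemma inner_self [simp]: "a i i \<bullet> z = 0"
  using inner_antisym[of i i z] by linarith

lemma subspace_lineality: "subspace (lineality I)"
  by (auto simp: subspace_def lineality_def inner_right_distrib)

lemma mem_lineality:
  assumes "J \<subseteq> cells I z"
  shows "z \<in> lineality J"
  unfolding lineality_def
proof (clarify)
  fix i j assume "i \<in> J" "j \<in> J"
  then have "0 \<le> a i j \<bullet> z" "0 \<le> a j i \<bullet> z"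
    using assms by (auto simp: cells_def)
  then show "a i j \<bullet> z = 0"
    using inner_antisym[of i j z] by linarith
qed

lemma cells_eq_all_iff: "cells I z = I \<longleftrightarrow> z \<in> lineality I"
proof
  assume "cells I z = I"
  then show "z \<in> lineality I" using mem_lineality[of I I z] by simp
qed (auto simp: cells_def lineality_def)

lemma cells_scale: "c > 0 \<Longrightarrow> cells I (c *\<^sub>R z) = cells I z"
  by (auto simp: cells_def zero_le_mult_iff)

lemma cells_add: "J \<subseteq> cells I x \<Longrightarrow> J \<subseteq> cells I y \<Longrightarrow> J \<subseteq> cells I (x + y)"
  by (simp add: cells_def subset_iff inner_right_distrib)

lemma cells_scale_nonneg: "J \<subseteq> cells I x \<Longrightarrow> c \<ge> 0 \<Longrightarrow> J \<subseteq> cells I (c *\<^sub>R x)"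
  by (auto simp: cells_def subset_iff)

lemma strict_in_cell:
  assumes "i \<in> I" "\<forall>j\<in>I - {i}. 0 < a i j \<bullet> s" "cells I s \<noteq> {}"
  shows "cells I s = {i}"
proof -
  have "j = i" if "j \<in> cells I s" for j
  proof (rule ccontr)
    assume "j \<noteq> i"
    with that assms have "0 < a i j \<bullet> s" "0 \<le> a j i \<bullet> s" by (auto simp: cells_def)
    then show False using inner_antisym[of i j s] by linarith
  qed
  with assms show ?thesis by blast
qed

section \<open>Topology and local structure of a tiling\<close>

lemma closed_cells: "closed {z. J \<subseteq> cells I z}"
proof (cases "J \<subseteq> I")
  case True
  then have "{z. J \<subseteq> cells I z} = (\<Inter>i\<in>J. \<Inter>j\<in>I. {z. 0 \<le> a i j \<bullet> z})"
    by (auto simp: cells_def)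
  then show ?thesis by (auto intro!: closed_INT simp: closed_halfspace_ge)
next
  case False
  then have "{z. J \<subseteq> cells I z} = {}" using cells_subset by blast
  then show ?thesis by simp
qed

text \<open>A cell missing \<open>z\<close> violates one of its inequalities strictly at
  \<open>z\<close>, which is an open condition, and there are finitely many cells.\<close>

lemma eventually_cells_subset:
  assumes "finite I"
  shows "\<forall>\<^sub>F y in nhds z. cells I y \<subseteq> cells I z"
proof -
  have "\<forall>\<^sub>F y in nhds z. i \<notin> cells I y" if i: "i \<in> I - cells I z" for i
  proof -
    obtain j where j: "j \<in> I" "a i j \<bullet> z < 0"
      using i by (auto simp: cells_def not_le)
    have "open {y. a i j \<bullet> y < 0}" by (rule open_halfspace_lt)
    then have "\<forall>\<^sub>F y in nhds z. a i j \<bullet> y < 0"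
      using j unfolding eventually_nhds by blast
    then show ?thesis
      by eventually_elim (use j in \<open>force simp: cells_def\<close>)
  qed
  then have "\<forall>\<^sub>F y in nhds z. \<forall>i\<in>I - cells I z. i \<notin> cells I y"
    using assms by (intro eventually_ball_finite) auto
  then show ?thesis
    by eventually_elim (use cells_subset in blast)
qed

text \<open>
  Near \<open>z\<close>, the tiling looks like the tiling by the cells containing \<open>z\<close>, even if a hyperplane
  separating one of them from a cell that does not contain \<open>z\<close> passes through \<open>z\<close>: every point
  of a cell is a limit of points at which all constraints are strict.
\<close>

lemma eventually_cells_eq:
  assumes "tiling I"
  shows "\<forall>\<^sub>F y in nhds z. cells I y = cells (cells I z) (y - z)"
proof -
  let ?J = "cells I z"
  have z0: "a i j \<bullet> z = 0" if "i \<in> ?J" "j \<in> ?J" for i j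
    using mem_lineality[of ?J I z] that by (auto simp: lineality_def)
  obtain U where U: "open U" "z \<in> U" "\<And>y. y \<in> U \<Longrightarrow> cells I y \<subseteq> ?J"
    using eventually_cells_subset[OF tiling_finite[OF assms], of z] unfolding eventually_nhds by blast
  have "cells I y = cells ?J (y - z)" if y: "y \<in> U" for y
  proof (intro subset_antisym subsetI)
    fix i assume i: "i \<in> cells I y"
    with U(3)[OF y] have iJ: "i \<in> ?J" by blast
    have "0 \<le> a i j \<bullet> (y - z)" if "j \<in> ?J" for j
    proof -
      have "0 \<le> a i j \<bullet> y" using i that cells_subset unfolding cells_def[of I y] by blast
      then show ?thesis using z0[OF iJ that] by (simp add: inner_diff_right)
    qed
    with iJ show "i \<in> cells ?J (y - z)" unfolding cells_def[of ?J] by blast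
  next
    fix i assume i: "i \<in> cells ?J (y - z)"
    then have iJ: "i \<in> ?J" using cells_subset by blast
    then have iI: "i \<in> I" using cells_subset by blast
    obtain s where s: "\<forall>j\<in>I - {i}. 0 < a i j \<bullet> s"
      using tiling_strict[OF assms iI] .
    have "((\<lambda>t. y + t *\<^sub>R s) \<longlongrightarrow> y + 0 *\<^sub>R s) (at_right 0)"
      by (intro tendsto_intros)
    then have "\<forall>\<^sub>F t in at_right 0. y + t *\<^sub>R s \<in> U"
      using U(1) y by (auto dest!: topological_tendstoD[where S=U])
    moreover have "\<forall>\<^sub>F t in at_right (0::real). t > 0"
      by (rule eventually_at_right_less)
    ultimately have ev: "\<forall>\<^sub>F t in at_right 0. y + t *\<^sub>R s \<in> {x. {i} \<subseteq> cells I x}"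
    proof eventually_elim
      case (elim t)
      obtain j where j: "j \<in> cells I (y + t *\<^sub>R s)"
        using tiling_cover[OF assms] by blast
      with U(3) elim have jJ: "j \<in> ?J" by blast
      \<comment> \<open>Cell \<open>j\<close> contains \<open>z\<close>, so the inequality of
        \<open>i\<close> against \<open>j\<close> holds at \<open>y\<close>. The push along
        \<open>s\<close> makes it strict, hence only \<open>i\<close> itself can cover the pushed
        point.\<close>
      have "j = i"
      proof (rule ccontr)
        assume "j \<noteq> i"
        then have "0 < a i j \<bullet> s" using s jJ cells_subset by blast
        moreover have "0 \<le> a i j \<bullet> y"
        proof -
          have "0 \<le> a i j \<bullet> (y - z)" using i jJ unfolding cells_def[of ?J] by blast
          then show ?thesis using z0[OF iJ jJ] by (simp add: inner_diff_right)
        qed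
        ultimately have "0 < a i j \<bullet> (y + t *\<^sub>R s)"
          using elim by (simp add: inner_right_distrib add_nonneg_pos)
        moreover have "0 \<le> a j i \<bullet> (y + t *\<^sub>R s)" using j iI by (auto simp: cells_def)
        ultimately show False using inner_antisym[of i j "y + t *\<^sub>R s"] by linarith
      qed
      with j show ?case by simp
    qed
    have "((\<lambda>t. y + t *\<^sub>R s) \<longlongrightarrow> y + 0 *\<^sub>R s) (at_right (0::real))"
      by (intro tendsto_intros)
    then have "y + 0 *\<^sub>R s \<in> {x. {i} \<subseteq> cells I x}"
      by (rule Lim_in_closed_set[OF closed_cells ev, rotated]) (simp add: trivial_limit_at_right_real)
    then show "i \<in> cells I y" by simp
  qed
  with U show ?thesis unfolding eventually_nhds by blast
qed

text \<open>The local tiling is invariant under positive scaling, so the small step length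
  \<open>t\<close> drops out.\<close>

lemma eventually_cells_ray:
  assumes "tiling I"
  shows "\<forall>\<^sub>F t in at_right 0. cells I (z + t *\<^sub>R w) = cells (cells I z) w"
proof -
  have "((\<lambda>t. z + t *\<^sub>R w) \<longlongrightarrow> z + 0 *\<^sub>R w) (at_right 0)"
    by (intro tendsto_intros)
  then have "filterlim (\<lambda>t. z + t *\<^sub>R w) (nhds z) (at_right 0)" by simp
  from eventually_compose_filterlim[OF eventually_cells_eq[OF assms] this]
  have "\<forall>\<^sub>F t in at_right 0. cells I (z + t *\<^sub>R w) = cells (cells I z) (t *\<^sub>R w)" by simp
  moreover have "\<forall>\<^sub>F t in at_right (0::real). t > 0"
    by (rule eventually_at_right_less)
  ultimately show ?thesis by eventually_elim (simp add: cells_scale)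
qed

lemma cells_ray:
  assumes "tiling I"
  obtains t where "t > 0" "cells I (z + t *\<^sub>R w) = cells (cells I z) w"
proof -
  have "\<forall>\<^sub>F t in at_right 0. cells I (z + t *\<^sub>R w) = cells (cells I z) w \<and> t > 0"
    using eventually_cells_ray[OF assms] eventually_at_right_less by eventually_elim simp
  from eventually_happens[OF this] show ?thesis using that by (auto simp: trivial_limit_at_right_real)
qed

text \<open>The inductions on the number of cells rest on this. Covering is inherited because the
  local cells are actual cells at a nearby point.\<close>

lemma tiling_cells:
  assumes "tiling I"
  shows "tiling (cells I z)"
  unfolding tiling_def
proof (intro conjI allI ballI)
  show "finite (cells I z)" by (rule finite_cells[OF assms])
  show "cells (cells I z) w \<noteq> {}" for w
    using cells_ray[OF assms, of z w] tiling_cover[OF assms] by metis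
  fix i assume "i \<in> cells I z"
  then have "i \<in> I" using cells_subset by blast
  then obtain s where "\<forall>j\<in>I - {i}. 0 < a i j \<bullet> s"
    using tiling_strict[OF assms] by blast
  then show "\<exists>s. \<forall>j\<in>cells I z - {i}. 0 < a i j \<bullet> s"
    using cells_subset by blast
qed

text \<open>
  If the cells at \<open>z\<close> also contained \<open>- z\<close>, they would be invariant under translation along \<open>z\<close>,
  hence cover the whole space, as they cover a neighbourhood of \<open>z\<close>.
\<close>

lemma not_cells_uminus:
  assumes "tiling I" "cells I z \<noteq> I"
  shows "\<not> cells I z \<subseteq> cells I (- z)"
proof
  assume opp: "cells I z \<subseteq> cells I (- z)"
  obtain i where i: "i \<in> I" "i \<notin> cells I z" using assms(2) cells_subset by blast
  then obtain s where s: "\<forall>j\<in>I - {i}. 0 < a i j \<bullet> s"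
    using tiling_strict[OF assms(1)] by blast
  obtain t where t: "t > 0" "cells I (z + t *\<^sub>R s) = cells (cells I z) s"
    using cells_ray[OF assms(1)] .
  obtain j where j: "j \<in> cells I (z + t *\<^sub>R s)"
    using tiling_cover[OF assms(1)] by blast
  with t have "j \<in> cells I z" using cells_subset by auto
  with opp have "j \<in> cells I (- z)" by blast
  \<comment> \<open>Adding \<open>- z\<close> stays in cell \<open>j\<close>, so
    \<open>t *\<^sub>R s\<close> and hence \<open>s\<close> lies in it, although \<open>s\<close>
    was chosen strictly inside cell \<open>i\<close>.\<close>
  then have "{j} \<subseteq> cells I ((z + t *\<^sub>R s) + (- z))"
    using j by (intro cells_add[of _ I "z + t *\<^sub>R s"]) blast+
  then have "j \<in> cells I s" using t(1) by (simp add: cells_scale)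
  moreover have "cells I s = {i}"
    using strict_in_cell[OF i(1) s tiling_cover[OF assms(1)]] .
  ultimately show False using i \<open>j \<in> cells I z\<close> by auto
qed

text \<open>Walk from \<open>z\<close> to \<open>- z\<close> on the side of \<open>e\<close>,
  staying in the lineality space. The cells at \<open>z\<close> do not all contain
  \<open>- z\<close>, and they can be left only through a point where a further cell joins
  them.\<close>

lemma cells_exit:
  assumes I: "tiling I" "cells I z \<noteq> I" and e: "e \<in> lineality (cells I z)"
  obtains \<alpha> \<beta> where "\<beta> > 0" "cells I z \<subset> cells I (\<alpha> *\<^sub>R z + \<beta> *\<^sub>R e)"
proof -
  let ?J = "cells I z"
  \<comment> \<open>The curve runs from \<open>z\<close> at 0 to \<open>- z\<close> at 1, and its
    coefficient of \<open>e\<close> is positive strictly in between.\<close>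
  define \<gamma> where "\<gamma> t = (1 - 2*t) *\<^sub>R z + (t * (1 - t)) *\<^sub>R e" for t :: real
  have cont: "continuous_on A \<gamma>" for A
    unfolding \<gamma>_def by (intro continuous_intros)
  have lin: "\<gamma> t \<in> lineality ?J" for t
    unfolding \<gamma>_def using e mem_lineality[of ?J I z]
    by (intro subspace_add subspace_scale subspace_lineality) auto
  define S where "S = {0..1} \<inter> {t. ?J \<subseteq> cells I (\<gamma> t)}"
  have "\<exists>t. 0 < t \<and> t < 1 \<and> ?J \<subset> cells I (\<gamma> t)"
  \<comment> \<open>Otherwise the times at which all cells of \<open>?J\<close> contain the curve
    form a clopen subset of the unit interval with 0 but without 1.\<close>
  proof (rule ccontr)
    assume "\<not> ?thesis"
    then have no: "cells I (\<gamma> t) = ?J" if "0 < t" "t < 1" "?J \<subseteq> cells I (\<gamma> t)" for t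
      using that by blast
    have "0 \<in> S" "1 \<notin> S"
      using not_cells_uminus[OF I] by (auto simp: S_def \<gamma>_def)
    \<comment> \<open>Near such a time only the cells \<open>?J\<close> matter, and points of the
      curve differ by elements of \<open>lineality ?J\<close>, which lie in all of them.\<close>
    have "open {t. cells I (\<gamma> t) = ?J}"
    proof (subst open_subopen, intro ballI)
      fix t assume "t \<in> {t. cells I (\<gamma> t) = ?J}"
      then have t: "cells I (\<gamma> t) = ?J" by simp
      have "isCont \<gamma> t" using cont[of UNIV] by (simp add: continuous_on_eq_continuous_at)
      then have "filterlim \<gamma> (nhds (\<gamma> t)) (nhds t)"
        by (simp add: isCont_def tendsto_at_iff_tendsto_nhds)
      from eventually_compose_filterlim[OF eventually_cells_eq[OF I(1)] this]
      have "\<forall>\<^sub>F t' in nhds t. cells I (\<gamma> t') = ?J"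
      proof eventually_elim
        case (elim t')
        have "\<gamma> t' - \<gamma> t \<in> lineality ?J"
          using lin by (intro subspace_diff subspace_lineality)
        then show ?case using elim t cells_eq_all_iff by auto
      qed
      then show "\<exists>T. open T \<and> t \<in> T \<and> T \<subseteq> {t. cells I (\<gamma> t) = ?J}"
        unfolding eventually_nhds by blast
    qed
    moreover have "S = {0..1} \<inter> {t. cells I (\<gamma> t) = ?J}"
    proof -
      have "cells I (\<gamma> t) = ?J" if "t \<in> S" for t
      proof (cases "t = 0")
        case True then show ?thesis by (simp add: \<gamma>_def)
      next
        case False
        with that \<open>1 \<notin> S\<close> have "0 < t" "t < 1" by (auto simp: S_def less_le)
        with no that show ?thesis by (auto simp: S_def)
      qed
      from this[unfolded S_def] show ?thesis unfolding S_def by blast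
    qed
    ultimately have "openin (top_of_set {0..1}) S" by (metis openin_open)
    moreover have "closed (\<gamma> -` {x. ?J \<subseteq> cells I x})"
      by (rule closed_vimage[OF closed_cells cont])
    then have "closedin (top_of_set {0..1}) S"
      unfolding S_def vimage_def by (auto simp: closedin_closed)
    moreover have "connected {0..1::real}" by simp
    ultimately have "S = {} \<or> S = {0..1}" unfolding connected_clopen by blast
    with \<open>0 \<in> S\<close> \<open>1 \<notin> S\<close> show False by auto
  qed
  then obtain t where t: "0 < t" "t < 1" "?J \<subset> cells I (\<gamma> t)" by blast
  then show ?thesis using that[of "t * (1 - t)" "1 - 2*t"] by (auto simp: \<gamma>_def)
qed

lemma lineality_neq_UNIV:
  assumes "tiling I" "card I \<ge> 2"
  obtains z where "z \<notin> lineality I"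
proof -
  obtain i where i: "i \<in> I" using assms(2) by fastforce
  then obtain s where s: "\<forall>j\<in>I - {i}. 0 < a i j \<bullet> s"
    using tiling_strict[OF assms(1)] by blast
  have "cells I s = {i}"
    using strict_in_cell[OF i s tiling_cover[OF assms(1)]] .
  then have "s \<notin> lineality I" using assms(2) cells_eq_all_iff[of I s] by auto
  with that show ?thesis .
qed

end

section \<open>Number of cells against dimension\<close>

lemma combination_notin_subspace:
  fixes W :: "'v::euclidean_space set"
  assumes "subspace W" "e \<notin> span (insert z W)" "\<beta> \<noteq> 0"
  shows "\<alpha> *\<^sub>R z + \<beta> *\<^sub>R e \<notin> W"
proof
  assume "\<alpha> *\<^sub>R z + \<beta> *\<^sub>R e \<in> W"
  then have "\<alpha> *\<^sub>R z + \<beta> *\<^sub>R e - \<alpha> *\<^sub>R z \<in> span (insert z W)"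
    by (intro span_diff span_scale) (auto intro: span_base)
  then have "(1/\<beta>) *\<^sub>R (\<beta> *\<^sub>R e) \<in> span (insert z W)"
    by (intro span_scale[of "\<beta> *\<^sub>R e"]) (simp only: add_diff_cancel_left')
  with assms show False by simp
qed

lemma obtain_outside_span_insert:
  fixes W V :: "'v::euclidean_space set"
  assumes "dim W + 2 \<le> dim V"
  obtains e where "e \<in> V" "e \<notin> span (insert z W)"
proof -
  have "\<not> V \<subseteq> span (insert z W)"
  proof
    assume "V \<subseteq> span (insert z W)"
    then have "dim V \<le> dim (insert z W)" by (metis dim_span dim_subset)
    also have "\<dots> \<le> dim W + 1" by (simp add: dim_insert)
    finally show False using assms by simp
  qed
  with that show ?thesis by blast
qed

context separating_vectors
begin

text \<open>Take \<open>z\<close> outside \<open>lineality I\<close> in as many cells as possible.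
  If its lineality space were two dimensions larger than that of \<open>I\<close>, it would contain
  an \<open>e\<close> independent of \<open>z\<close> modulo \<open>lineality I\<close>, and
  \<open>cells_exit\<close> would reach a point outside \<open>lineality I\<close> in more
  cells.\<close>

lemma maximal_cells:
  assumes I: "tiling I" "card I \<ge> 2"
  obtains z where "z \<notin> lineality I" "cells I z \<subset> I"
    "dim (lineality (cells I z)) \<le> dim (lineality I) + 1"
proof -
  obtain z0 where z0: "z0 \<notin> lineality I" using lineality_neq_UNIV[OF I] .
  define N where "N = (\<lambda>z. card (cells I z)) ` (- lineality I)"
  have "finite N"
  proof (rule finite_subset)
    show "N \<subseteq> {..card I}"
      using card_mono[OF tiling_finite[OF I(1)] cells_subset] by (auto simp: N_def)
  qed simp
  moreover have "N \<noteq> {}" using z0 by (auto simp: N_def)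
  ultimately have "Max N \<in> N" "\<And>n. n \<in> N \<Longrightarrow> n \<le> Max N" by auto
  then obtain z where z: "z \<notin> lineality I"
    and mx: "\<And>w. w \<notin> lineality I \<Longrightarrow> card (cells I w) \<le> card (cells I z)"
    by (auto simp: N_def)
  have proper: "cells I z \<noteq> I" using z cells_eq_all_iff by blast
  have "dim (lineality (cells I z)) \<le> dim (lineality I) + 1"
  proof (rule ccontr)
    assume "\<not> ?thesis"
    then have "dim (lineality I) + 2 \<le> dim (lineality (cells I z))" by simp
    then obtain e where e: "e \<in> lineality (cells I z)" "e \<notin> span (insert z (lineality I))"
      by (rule obtain_outside_span_insert)
    obtain \<alpha> \<beta> where ab: "\<beta> > 0" "cells I z \<subset> cells I (\<alpha> *\<^sub>R z + \<beta> *\<^sub>R e)"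
      using cells_exit[OF I(1) proper e(1)] .
    then have "\<alpha> *\<^sub>R z + \<beta> *\<^sub>R e \<notin> lineality I"
      using combination_notin_subspace[OF subspace_lineality e(2)] by simp
    from mx[OF this] psubset_card_mono[OF finite_cells[OF I(1)] ab(2)] show False by simp
  qed
  with that z proper cells_subset show ?thesis by blast
qed

text \<open>Passing to the local tiling at a point from \<open>maximal_cells\<close> loses at least
  one cell and gains at most one dimension of lineality. A single cell has the whole space as
  lineality space.\<close>

lemma dim_lineality:
  assumes "tiling I"
  shows "DIM('v) + 1 \<le> card I + dim (lineality I)"
  using assms
proof (induction "card I" arbitrary: I rule: less_induct)
  case less
  have "finite I" "I \<noteq> {}"
    using tiling_finite[OF less.prems] tiling_cover[OF less.prems] cells_subset by blast+
  then consider "card I = 1" | "card I \<ge> 2"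
    by (metis One_nat_def Suc_1 Suc_leI card_gt_0_iff le_neq_implies_less)
  then show ?case
  proof cases
    case 1
    then obtain i where "I = {i}" by (auto simp: card_1_singleton_iff)
    then have "lineality I = UNIV" by (auto simp: lineality_def)
    with 1 show ?thesis by simp
  next
    case 2
    obtain z where z: "cells I z \<subset> I"
      "dim (lineality (cells I z)) \<le> dim (lineality I) + 1"
      using maximal_cells[OF less.prems 2] .
    have lt: "card (cells I z) < card I" using z(1) \<open>finite I\<close> by (rule psubset_card_mono[rotated])
    have "DIM('v) + 1 \<le> card (cells I z) + dim (lineality (cells I z))"
      by (rule less.hyps[OF lt tiling_cells[OF less.prems]])
    with lt z show ?thesis by simp
  qed
qed

lemma cells_zero: "cells I 0 = I"
  by (simp add: cells_eq_all_iff lineality_def)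

text \<open>This is the equality case of \<open>dim_lineality\<close>, modelled on the normal fan of
  a simplex. By induction some \<open>z\<close> omits exactly \<open>j\<^sub>0\<close> and another
  cell \<open>j\<^sub>1\<close>; of two exits from \<open>z\<close> in opposite directions, at least
  one regains \<open>j\<^sub>1\<close>.\<close>

lemma cells_omitting_one:
  assumes "tiling I" "card I \<ge> 2" "card I + dim (lineality I) = DIM('v) + 1" "j\<^sub>0 \<in> I"
  shows "\<exists>z. cells I z = I - {j\<^sub>0}"
  using assms
proof (induction "card I" arbitrary: I rule: less_induct)
  case less
  have fin: "finite I" by (rule tiling_finite[OF less.prems(1)])
  obtain z\<^sub>1 where z1: "cells I z\<^sub>1 \<subset> I"
    "dim (lineality (cells I z\<^sub>1)) \<le> dim (lineality I) + 1"
    using maximal_cells[OF less.prems(1,2)] .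
  let ?J = "cells I z\<^sub>1"
  have tJ: "tiling ?J" by (rule tiling_cells[OF less.prems(1)])
  have lt: "card ?J < card I" using z1(1) fin by (rule psubset_card_mono[rotated])
  have dJ: "DIM('v) + 1 \<le> card ?J + dim (lineality ?J)" by (rule dim_lineality[OF tJ])
  \<comment> \<open>Both bounds are tight, so the maximal point omits exactly one cell and its local
    tiling is again an equality case.\<close>
  have cJ: "card ?J + 1 = card I" "card ?J + dim (lineality ?J) = DIM('v) + 1"
    using dJ lt z1 less.prems(3) by auto
  have "card (I - ?J) = 1"
    using cJ z1(1) fin by (subst card_Diff_subset) (auto intro: finite_subset)
  then obtain j\<^sub>1 where "I - ?J = {j\<^sub>1}" by (auto simp: card_1_singleton_iff)
  then have j1: "j\<^sub>1 \<in> I" "?J = I - {j\<^sub>1}" using z1(1) by auto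
  show ?case
  proof (cases "j\<^sub>1 = j\<^sub>0")
    case True
    then show ?thesis using j1 by blast
  next
    case ne: False
    show ?thesis
    proof (cases "card I = 2")
      case True
      \<comment> \<open>With two cells the local tiling has only one, too few for the induction
        hypothesis; a point strictly inside cell \<open>j\<^sub>1\<close> serves directly.\<close>
      have "card {j\<^sub>0, j\<^sub>1} = card I" using True ne by auto
      then have I: "I = {j\<^sub>0, j\<^sub>1}"
        using card_subset_eq[OF fin, of "{j\<^sub>0, j\<^sub>1}"] j1 less.prems(4) by auto
      obtain s where s: "\<forall>j\<in>I - {j\<^sub>1}. 0 < a j\<^sub>1 j \<bullet> s"
        using tiling_strict[OF less.prems(1) j1(1)] .
      have "cells I s = {j\<^sub>1}"
        using strict_in_cell[OF j1(1) s tiling_cover[OF less.prems(1)]] .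
      moreover have "I - {j\<^sub>0} = {j\<^sub>1}" using I ne by auto
      ultimately show ?thesis by (intro exI[of _ s]) simp
    next
      case False
      then have c2: "card ?J \<ge> 2" using cJ less.prems(2) by simp
      have "j\<^sub>0 \<in> ?J" using j1 ne less.prems(4) by auto
      then obtain w where w: "cells ?J w = ?J - {j\<^sub>0}"
        using less.hyps[OF lt tJ c2 cJ(2)] by blast
      obtain t where t: "t > 0" "cells I (z\<^sub>1 + t *\<^sub>R w) = cells ?J w"
        using cells_ray[OF less.prems(1)] .
      define z where "z = z\<^sub>1 + t *\<^sub>R w"
      define J where "J = I - {j\<^sub>0, j\<^sub>1}"
      have z: "cells I z = J" using t w j1 by (auto simp: z_def J_def)
      have JI: "J \<noteq> I" using j1 by (auto simp: J_def)
      have "card J + 2 = card I"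
        using fin ne j1 less.prems(4) card_mono[OF fin, of "{j\<^sub>0, j\<^sub>1}"]
        unfolding J_def by (subst card_Diff_subset) auto
      moreover have "DIM('v) + 1 \<le> card J + dim (lineality J)"
        using dim_lineality[OF tiling_cells[OF less.prems(1), of z]] z by simp
      ultimately have "dim (lineality I) + 2 \<le> dim (lineality J)"
        using less.prems(3) by simp
      then obtain e where e: "e \<in> lineality J" "e \<notin> span (insert z (lineality I))"
        by (rule obtain_outside_span_insert)
      have e': "- e \<in> lineality J" using e(1) by (intro subspace_neg subspace_lineality)
      obtain \<alpha> \<beta> where ab: "\<beta> > 0" "J \<subset> cells I (\<alpha> *\<^sub>R z + \<beta> *\<^sub>R e)"
        using cells_exit[OF less.prems(1), of z e] z JI e by metis
      obtain \<alpha>' \<beta>' where ab': "\<beta>' > 0" "J \<subset> cells I (\<alpha>' *\<^sub>R z + \<beta>' *\<^sub>R (- e))"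
        using cells_exit[OF less.prems(1), of z "- e"] z JI e' by metis
      define v where "v = \<alpha> *\<^sub>R z + \<beta> *\<^sub>R e"
      define v' where "v' = \<alpha>' *\<^sub>R z + (- \<beta>') *\<^sub>R e"
      have nW: "v \<notin> lineality I" "v' \<notin> lineality I"
        using combination_notin_subspace[OF subspace_lineality e(2)] ab ab'
        by (auto simp: v_def v'_def simp del: scaleR_minus_left)
      have cases: "cells I x = I - {j\<^sub>0} \<or> cells I x = I - {j\<^sub>1}"
        if "x \<notin> lineality I" "J \<subset> cells I x" for x
        using that cells_subset[of I x] cells_eq_all_iff[of I x] unfolding J_def by blast
      have "cells I v = I - {j\<^sub>0} \<or> cells I v' = I - {j\<^sub>0}"
      proof (rule ccontr)
        assume "\<not> ?thesis"
        then have c: "cells I v = I - {j\<^sub>1}" "cells I v' = I - {j\<^sub>1}"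
          using cases nW ab ab' by (auto simp: v_def v'_def)
        define c where "c = \<beta>' * \<alpha> + \<beta> * \<alpha>'"
        \<comment> \<open>The positive weights cancel \<open>e\<close>, so this point of the cells
          common to \<open>v\<close> and \<open>v'\<close> lies on the line of \<open>z\<close>.
          Positive \<open>c\<close> would put \<open>z\<close> in cell \<open>j\<^sub>0\<close>,
          negative \<open>c\<close> would put \<open>- z\<close> in all cells at \<open>z\<close>,
          and zero would make \<open>v\<close> and \<open>v'\<close> opposite.\<close>
        have sum: "\<beta>' *\<^sub>R v + \<beta> *\<^sub>R v' = c *\<^sub>R z"
          by (simp add: v_def v'_def c_def algebra_simps)
        have sub: "I - {j\<^sub>1} \<subseteq> cells I (c *\<^sub>R z)"
          unfolding sum[symmetric] using ab ab' c by (intro cells_add cells_scale_nonneg) auto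
        consider "c > 0" | "c < 0" | "c = 0" by linarith
        then show False
        proof cases
          case 1
          then have "I - {j\<^sub>1} \<subseteq> J" using sub z by (simp add: cells_scale)
          then show False using less.prems(4) ne by (auto simp: J_def)
        next
          case 2
          then have "cells I (c *\<^sub>R z) = cells I (- z)"
            using cells_scale[of "- c" I "- z"] by simp
          then show False
            using not_cells_uminus[OF less.prems(1), of z] sub z JI by (auto simp: J_def)
        next
          case 3
          then have "\<beta> *\<^sub>R v' = \<beta>' *\<^sub>R (- v)" using sum by (simp add: eq_neg_iff_add_eq_0 add.commute)
          then have "cells I v' = cells I (- v)"
            using cells_scale ab(1) ab'(1) by metis
          then show False
            using not_cells_uminus[OF less.prems(1), of v] c j1 by auto
        qed
      qed
      then show ?thesis by blast
    qed
  qed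
qed

end

section \<open>Vertices and edges of a generic tiling\<close>

locale generic_tiling = separating_vectors a for a :: "'i \<Rightarrow> 'i \<Rightarrow> 'v::euclidean_space" +
  fixes I :: "'i set"
  assumes tiling: "tiling I"
    and generic: "z \<noteq> 0 \<Longrightarrow> card (cells I z) \<le> DIM('v)"
    and card_gt: "DIM('v) < card I"
begin

text \<open>A vertex already attains the generic bound, so no exit in a direction independent of
  \<open>v\<close> can gain a cell.\<close>

lemma vertex_lineality:
  assumes v: "card (cells I v) = DIM('v)" and w: "w \<in> lineality (cells I v)"
  shows "w \<in> span {v}"
proof (rule ccontr)
  assume "w \<notin> span {v}"
  then have w': "w \<notin> span (insert v {0})" by (simp add: insert_commute)
  have vI: "cells I v \<noteq> I" using v card_gt by auto
  obtain \<alpha> \<beta> where ab: "\<beta> > 0" "cells I v \<subset> cells I (\<alpha> *\<^sub>R v + \<beta> *\<^sub>R w)"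
    using cells_exit[OF tiling vI w] .
  have "\<alpha> *\<^sub>R v + \<beta> *\<^sub>R w \<noteq> 0"
    using combination_notin_subspace[OF subspace_single_0 w'] ab(1) by simp
  from generic[OF this] psubset_card_mono[OF finite_cells[OF tiling] ab(2)] v
  show False by simp
qed

text \<open>The cells of a vertex determine its ray: \<open>w\<close> lies on the line of
  \<open>v\<close>, and \<open>not_cells_uminus\<close> excludes the negative side.\<close>

lemma vertex_ray:
  assumes v: "card (cells I v) = DIM('v)" and w: "w \<noteq> 0" "cells I v \<subseteq> cells I w"
  obtains c where "c > 0" "w = c *\<^sub>R v"
proof -
  obtain c where c: "w = c *\<^sub>R v"
    using vertex_lineality[OF v mem_lineality[OF w(2)]] by (auto simp: span_singleton)
  have "\<not> c < 0"
  proof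
    assume "c < 0"
    then have "cells I w = cells I (- v)"
      using cells_scale[of "- c" I "- v"] c by simp
    then show False
      using not_cells_uminus[OF tiling, of v] v w(2) card_gt by (metis less_irrefl)
  qed
  with c w(1) that[of c] show ?thesis by (cases "c = 0") auto
qed

text \<open>
  The cone of all points contained in the cells \<open>J\<close> contains \<open>z\<close> in its relative interior,
  hence also \<open>x + d z\<close>, whereas a vertex lies on its relative boundary.
\<close>

lemma not_vertex_translate:
  assumes z: "cells I z = J" and x: "J \<subseteq> cells I x" and d: "d > 0"
  shows "\<not> (cells I (x + d *\<^sub>R z) = insert j J \<and> j \<notin> J \<and> card J + 1 = DIM('v))"
proof
  let ?y = "x + d *\<^sub>R z"
  assume y: "cells I ?y = insert j J \<and> j \<notin> J \<and> card J + 1 = DIM('v)"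
  have finJ: "finite J" using finite_cells[OF tiling, of z] z by simp
  \<comment> \<open>Moving \<open>?y\<close> by \<open>t *\<^sub>R w\<close> amounts to moving
    \<open>z\<close> by \<open>(t/d) *\<^sub>R w\<close>, which keeps all cells of \<open>J\<close>
    for small \<open>t\<close>. So \<open>w\<close> lies in these cells for the local tiling at
    \<open>?y\<close>.\<close>
  have sub: "J \<subseteq> cells (insert j J) w" if w: "w \<in> lineality J" for w
  proof -
    have "\<forall>\<^sub>F t in at_right 0. cells I (?y + t *\<^sub>R w) = cells (insert j J) w"
      using eventually_cells_ray[OF tiling, of ?y w] y by simp
    moreover have "\<forall>\<^sub>F t in at_right 0. cells I (z + t *\<^sub>R ((1/d) *\<^sub>R w)) = J"
      using eventually_cells_ray[OF tiling, of z "(1/d) *\<^sub>R w"] z d w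
      by (simp add: cells_scale cells_eq_all_iff[THEN iffD2])
    ultimately have "\<forall>\<^sub>F t in at_right (0::real). J \<subseteq> cells (insert j J) w"
    proof eventually_elim
      case (elim t)
      have "J \<subseteq> cells I (x + d *\<^sub>R (z + t *\<^sub>R ((1/d) *\<^sub>R w)))"
        using d elim by (intro cells_add[OF x] cells_scale_nonneg) auto
      also have "x + d *\<^sub>R (z + t *\<^sub>R ((1/d) *\<^sub>R w)) = ?y + t *\<^sub>R w"
        using d by (simp add: algebra_simps)
      finally show ?case using elim by simp
    qed
    then show ?thesis by (simp add: trivial_limit_at_right_real)
  qed
  have zJ: "z \<in> lineality J" using mem_lineality[of J I z] z by simp
  \<comment> \<open>Using both \<open>z\<close> and \<open>- z\<close> turns the inequalities
    against \<open>j\<close> into equations. Then \<open>z\<close> lies on the line of the vertex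
    \<open>?y\<close>, which no sign of the factor permits.\<close>
  have "z \<in> lineality (insert j J)"
  proof -
    have mz: "- z \<in> lineality J" using zJ by (intro subspace_neg subspace_lineality)
    have "a i j \<bullet> z = 0" if "i \<in> J" for i
    proof -
      have "0 \<le> a i j \<bullet> z" using sub[OF zJ] that by (auto simp: cells_def)
      moreover have "0 \<le> a i j \<bullet> (- z)" using sub[OF mz] that unfolding cells_def by blast
      ultimately show ?thesis by simp
    qed
    moreover from this have "a j i \<bullet> z = 0" if "i \<in> J" for i
      using that inner_antisym[of j i z] by simp
    ultimately show ?thesis using zJ by (simp add: lineality_def)
  qed
  moreover have "card (cells I ?y) = DIM('v)" using y finJ by simp
  ultimately obtain c where c: "z = c *\<^sub>R ?y"
    using vertex_lineality[of ?y z] y by (auto simp: span_singleton)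
  have zI: "cells I z \<noteq> I" using z y card_gt by auto
  consider "c > 0" | "c = 0" | "c < 0" by linarith
  then show False
  proof cases
    case 1
    then have "cells I z = insert j J" using c y cells_scale by metis
    then show False using z y by auto
  next
    case 2
    then show False using c zI cells_zero by simp
  next
    case 3
    have "(- c) *\<^sub>R ?y = - z" using c by (metis scaleR_minus_left)
    then have "cells I (- z) = insert j J" using cells_scale[of "- c" I ?y] 3 y by simp
    then show False using not_cells_uminus[OF tiling zI] z by auto
  qed
qed

text \<open>\<open>lineality J\<close> is a plane, cut by the line of \<open>z\<close> into two
  sides. Each side holds exactly one vertex ray whose cells contain \<open>J\<close>, found by
  leaving \<open>z\<close> along \<open>e\<close> or \<open>- e\<close>.\<close>

lemma card_vertices_edge:
  assumes J: "card J + 1 = DIM('v)" and z: "cells I z = J"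
  shows "card {j \<in> I - J. \<exists>v. v \<noteq> 0 \<and> cells I v = insert j J} = 2"
proof -
  have finJ: "finite J" using finite_cells[OF tiling, of z] z by simp
  have JI: "J \<noteq> I" using J card_gt by auto
  have zJ: "z \<in> lineality J" using mem_lineality[of J I z] z by simp
  have opp: "\<not> J \<subseteq> cells I (- z)" using not_cells_uminus[OF tiling, of z] z JI by simp
  \<comment> \<open>By genericity the exit point gains exactly one cell.\<close>
  have exit: "\<exists>\<alpha> \<beta> j. \<beta> > 0 \<and> j \<in> I - J \<and> \<alpha> *\<^sub>R z + \<beta> *\<^sub>R e \<noteq> 0 \<and> cells I (\<alpha> *\<^sub>R z + \<beta> *\<^sub>R e) = insert j J"
    if e: "e \<in> lineality J" "e \<notin> span {z}" for e
  proof -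
    obtain \<alpha> \<beta> where ab: "\<beta> > 0" "J \<subset> cells I (\<alpha> *\<^sub>R z + \<beta> *\<^sub>R e)"
      using cells_exit[OF tiling, of z e] z JI e(1) by metis
    let ?v = "\<alpha> *\<^sub>R z + \<beta> *\<^sub>R e"
    have nz: "?v \<noteq> 0"
      using combination_notin_subspace[OF subspace_single_0, of e z] e(2) ab(1)
      by (simp add: insert_commute)
    have fin: "finite (cells I ?v)" by (rule finite_cells[OF tiling])
    obtain j where j: "j \<in> cells I ?v" "j \<notin> J" using ab(2) by blast
    have "insert j J = cells I ?v"
    proof (rule card_seteq[OF fin])
      show "card (cells I ?v) \<le> card (insert j J)"
        using generic[OF nz] j finJ J by simp
    qed (use j ab(2) in auto)
    with ab j nz cells_subset show ?thesis by blast
  qed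
  have vcard: "card (cells I v) = DIM('v)" if "cells I v = insert j J" "j \<in> I - J" for v j
    using that J finJ by simp
  \<comment> \<open>With a third independent direction \<open>e'\<close>, every real
    \<open>t\<close> would give an exit vertex for \<open>e + t *\<^sub>R e'\<close>. Only finitely
    many cells can be gained, so two of these vertices share all cells and lie on one ray,
    contradicting independence.\<close>
  have plane: "e' \<in> span {z, e}"
    if e: "e \<in> lineality J" "e \<notin> span {z}" and e': "e' \<in> lineality J" for e e'
  proof (rule ccontr)
    assume ne': "e' \<notin> span {z, e}"
    have "\<exists>\<alpha> \<beta> j. \<beta> > 0 \<and> j \<in> I - J \<and> \<alpha> *\<^sub>R z + \<beta> *\<^sub>R (e + t *\<^sub>R e') \<noteq> 0 \<and>
        cells I (\<alpha> *\<^sub>R z + \<beta> *\<^sub>R (e + t *\<^sub>R e')) = insert j J" for t :: real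
    proof (rule exit)
      show "e + t *\<^sub>R e' \<in> lineality J"
        using e e' by (intro subspace_add subspace_scale subspace_lineality)
      show "e + t *\<^sub>R e' \<notin> span {z}"
      proof (cases "t = 0")
        case False
        have "1 *\<^sub>R e + t *\<^sub>R e' \<notin> span {z}"
        proof (rule combination_notin_subspace[OF subspace_span _ False])
          have "insert e (span {z}) \<subseteq> span {z, e}"
            using span_mono[of "{z}" "{z, e}"] by (auto intro: span_base)
          then have "span (insert e (span {z})) \<subseteq> span {z, e}"
            by (rule span_minimal[OF _ subspace_span])
          then show "e' \<notin> span (insert e (span {z}))" using ne' by blast
        qed
        then show ?thesis by simp
      qed (use e in simp)
    qed
    then obtain \<alpha> \<beta> :: "real \<Rightarrow> real" and j where v:
      "\<And>t. \<beta> t > 0" "\<And>t. j t \<in> I - J"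
      "\<And>t. \<alpha> t *\<^sub>R z + \<beta> t *\<^sub>R (e + t *\<^sub>R e') \<noteq> 0"
      "\<And>t. cells I (\<alpha> t *\<^sub>R z + \<beta> t *\<^sub>R (e + t *\<^sub>R e')) = insert (j t) J"
      by metis
    have "finite (range j)"
      using v(2) tiling_finite[OF tiling] by (auto intro: finite_subset[of _ I])
    then have "\<not> inj j"
      using finite_imageD infinite_UNIV_char_0 by blast
    then obtain s t where st: "s \<noteq> t" "j s = j t" by (auto simp: inj_def)
    obtain c where c: "c > 0" "\<alpha> t *\<^sub>R z + \<beta> t *\<^sub>R (e + t *\<^sub>R e') = c *\<^sub>R (\<alpha> s *\<^sub>R z + \<beta> s *\<^sub>R (e + s *\<^sub>R e'))"
      using vertex_ray[OF vcard[OF v(4) v(2)] v(3), of s t] v(4) st by auto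
    have *: "(\<alpha> t - c * \<alpha> s) *\<^sub>R z + (\<beta> t - c * \<beta> s) *\<^sub>R e = (c * \<beta> s * s - \<beta> t * t) *\<^sub>R e'"
      using c(2) by (simp add: algebra_simps)
    have "c * \<beta> s * s - \<beta> t * t = 0"
    proof (rule ccontr)
      assume nz: "c * \<beta> s * s - \<beta> t * t \<noteq> 0"
      have "(c * \<beta> s * s - \<beta> t * t) *\<^sub>R e' \<in> span {z, e}"
        unfolding *[symmetric] by (intro span_add span_scale span_base) auto
      from span_scale[OF this, of "1 / (c * \<beta> s * s - \<beta> t * t)"] show False
        using ne' nz by simp
    qed
    moreover have "\<beta> t - c * \<beta> s = 0"
    proof (rule ccontr)
      assume nz: "\<beta> t - c * \<beta> s \<noteq> 0"
      have "(\<alpha> t - c * \<alpha> s) *\<^sub>R z + (\<beta> t - c * \<beta> s) *\<^sub>R e \<notin> {0}"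
        using e(2) by (intro combination_notin_subspace[OF subspace_single_0 _ nz])
          (simp add: insert_commute)
      then show False using * calculation by simp
    qed
    ultimately have "\<beta> t * (s - t) = 0" by (simp add: algebra_simps)
    then show False using v(1)[of t] st by simp
  qed
  \<comment> \<open>Suitably scaled, two exits on the same side differ by
    \<open>?d *\<^sub>R z\<close>. Positive \<open>?d\<close> is excluded by
    \<open>not_vertex_translate\<close>, and \<open>?d = 0\<close> means the same cells.\<close>
  have uniq: "j = j'"
    if "\<beta> > 0" "\<beta>' > 0" "j \<in> I - J" "j' \<in> I - J"
      "cells I (\<alpha> *\<^sub>R z + \<beta> *\<^sub>R e) = insert j J" "cells I (\<alpha>' *\<^sub>R z + \<beta>' *\<^sub>R e) = insert j' J"
      "\<beta>' * \<alpha> \<le> \<beta> * \<alpha>'"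
    for \<alpha> \<beta> \<alpha>' \<beta>' j j' e
  proof -
    let ?d = "\<beta> * \<alpha>' - \<beta>' * \<alpha>"
    have u: "cells I (\<beta>' *\<^sub>R (\<alpha> *\<^sub>R z + \<beta> *\<^sub>R e)) = insert j J"
      using that cells_scale by simp
    have "cells I (\<beta> *\<^sub>R (\<alpha>' *\<^sub>R z + \<beta>' *\<^sub>R e)) = insert j' J"
      using that cells_scale by simp
    also have "\<beta> *\<^sub>R (\<alpha>' *\<^sub>R z + \<beta>' *\<^sub>R e) = \<beta>' *\<^sub>R (\<alpha> *\<^sub>R z + \<beta> *\<^sub>R e) + ?d *\<^sub>R z"
      by (simp add: algebra_simps)
    finally have u': "cells I (\<beta>' *\<^sub>R (\<alpha> *\<^sub>R z + \<beta> *\<^sub>R e) + ?d *\<^sub>R z) = insert j' J" .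
    have "\<not> ?d > 0"
      using not_vertex_translate[OF z, of "\<beta>' *\<^sub>R (\<alpha> *\<^sub>R z + \<beta> *\<^sub>R e)" ?d j'] u u' that(4) J by auto
    then have "?d = 0" using that by simp
    then show "j = j'" using u u' that(3,4) by auto
  qed
  have uniq': "j = j'"
    if "\<beta> > 0" "\<beta>' > 0" "j \<in> I - J" "j' \<in> I - J"
      "cells I (\<alpha> *\<^sub>R z + \<beta> *\<^sub>R e) = insert j J" "cells I (\<alpha>' *\<^sub>R z + \<beta>' *\<^sub>R e) = insert j' J"
    for \<alpha> \<beta> \<alpha>' \<beta>' j j' e
    using uniq[OF that] uniq[OF that(2,1,4,3,6,5)] by fastforce
  have "DIM('v) + 1 \<le> card J + dim (lineality J)"
    using dim_lineality[OF tiling_cells[OF tiling, of z]] z by simp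
  then have "dim {0::'v} + 2 \<le> dim (lineality J)" using J by simp
  then obtain e where "e \<in> lineality J" "e \<notin> span (insert z {0})"
    by (rule obtain_outside_span_insert)
  then have e: "e \<in> lineality J" "e \<notin> span {z}" by (auto simp: insert_commute)
  then have me: "- e \<in> lineality J" "- e \<notin> span {z}"
    using span_neg[of "- e" "{z}"] by (auto intro: subspace_neg subspace_lineality)
  obtain \<alpha>\<^sub>1 \<beta>\<^sub>1 j\<^sub>1 where 1: "\<beta>\<^sub>1 > 0" "j\<^sub>1 \<in> I - J" "\<alpha>\<^sub>1 *\<^sub>R z + \<beta>\<^sub>1 *\<^sub>R e \<noteq> 0"
    "cells I (\<alpha>\<^sub>1 *\<^sub>R z + \<beta>\<^sub>1 *\<^sub>R e) = insert j\<^sub>1 J"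
    using exit[OF e] by blast
  obtain \<alpha>\<^sub>2 \<beta>\<^sub>2 j\<^sub>2 where 2: "\<beta>\<^sub>2 > 0" "j\<^sub>2 \<in> I - J" "\<alpha>\<^sub>2 *\<^sub>R z + \<beta>\<^sub>2 *\<^sub>R (- e) \<noteq> 0"
    "cells I (\<alpha>\<^sub>2 *\<^sub>R z + \<beta>\<^sub>2 *\<^sub>R (- e)) = insert j\<^sub>2 J"
    using exit[OF me] by blast
  \<comment> \<open>Vertices with equal cells lie on one ray, but here the coefficients of
    \<open>e\<close> have opposite signs.\<close>
  have "j\<^sub>1 \<noteq> j\<^sub>2"
  proof
    assume eq: "j\<^sub>1 = j\<^sub>2"
    obtain c where c: "c > 0" "\<alpha>\<^sub>2 *\<^sub>R z + \<beta>\<^sub>2 *\<^sub>R (- e) = c *\<^sub>R (\<alpha>\<^sub>1 *\<^sub>R z + \<beta>\<^sub>1 *\<^sub>R e)"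
      using vertex_ray[OF vcard[OF 1(4,2)] 2(3)] 1(4) 2(4) eq by auto
    have "(c * \<alpha>\<^sub>1 - \<alpha>\<^sub>2) *\<^sub>R z + (c * \<beta>\<^sub>1 + \<beta>\<^sub>2) *\<^sub>R e \<notin> {0}"
    proof (rule combination_notin_subspace[OF subspace_single_0])
      show "e \<notin> span {z, 0}" using e(2) by (simp add: insert_commute)
      have "c * \<beta>\<^sub>1 + \<beta>\<^sub>2 > 0" using c(1) 1(1) 2(1) by (simp add: add_pos_pos)
      then show "c * \<beta>\<^sub>1 + \<beta>\<^sub>2 \<noteq> 0" by simp
    qed
    moreover have "(c * \<alpha>\<^sub>1 - \<alpha>\<^sub>2) *\<^sub>R z + (c * \<beta>\<^sub>1 + \<beta>\<^sub>2) *\<^sub>R e = 0"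
      using c(2) by (simp add: algebra_simps)
    ultimately show False by simp
  qed
  moreover have "{j \<in> I - J. \<exists>v. v \<noteq> 0 \<and> cells I v = insert j J} = {j\<^sub>1, j\<^sub>2}"
  proof (intro subset_antisym subsetI)
    fix j assume "j \<in> {j \<in> I - J. \<exists>v. v \<noteq> 0 \<and> cells I v = insert j J}"
    then obtain v where v: "j \<in> I - J" "v \<noteq> 0" "cells I v = insert j J" by blast
    have "v \<in> lineality J" using v(3) by (intro mem_lineality[of _ I]) auto
    then have "v \<in> span {z, e}" by (rule plane[OF e])
    then obtain \<alpha> \<beta> where ab: "v = \<alpha> *\<^sub>R z + \<beta> *\<^sub>R e"
      by (auto simp: span_insert span_singleton algebra_simps)
    \<comment> \<open>A nonzero multiple of \<open>z\<close> has the cells of \<open>z\<close> or of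
      \<open>- z\<close>, and neither set is \<open>insert j J\<close>.\<close>
    have "\<beta> \<noteq> 0"
    proof
      assume "\<beta> = 0"
      then have va: "v = \<alpha> *\<^sub>R z" using ab by simp
      consider "\<alpha> > 0" | "\<alpha> = 0" | "\<alpha> < 0" by linarith
      then show False
      proof cases
        case 1
        then show False using va cells_scale[of \<alpha> I z] z v by auto
      next
        case 2
        then show False using va v by simp
      next
        case 3
        then have "cells I v = cells I (- z)"
          using cells_scale[of "- \<alpha>" I "- z"] va by simp
        then show False using opp v by auto
      qed
    qed
    then consider "\<beta> > 0" | "- \<beta> > 0" by linarith
    then show "j \<in> {j\<^sub>1, j\<^sub>2}"
    proof cases
      case c: 1
      then show ?thesis using uniq'[OF c 1(1) v(1) 1(2) _ 1(4)] v ab by auto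
    next
      case c: 2
      have "v = \<alpha> *\<^sub>R z + (- \<beta>) *\<^sub>R (- e)" using ab by simp
      then show ?thesis using uniq'[OF c 2(1) v(1) 2(2) _ 2(4)] v by auto
    qed
  qed (use 1 2 in blast)
  ultimately show ?thesis by simp
qed

text \<open>An edge has two vertices. If no point has exactly the cells \<open>J\<close>, there is
  no vertex next to \<open>J\<close>, except in dimension 1, where \<open>J\<close> is empty and the
  two rays of the line are the vertices.\<close>

lemma even_vertices:
  assumes J: "card J + 1 = DIM('v)" "finite J"
  shows "even (card {j \<in> I - J. \<exists>v. v \<noteq> 0 \<and> cells I v = insert j J})" (is "even (card ?V)")
proof (cases "\<exists>z. cells I z = J")
  case True
  then show ?thesis using card_vertices_edge[OF J(1)] by auto
next
  case nz: False
  show ?thesis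
  proof (cases "DIM('v) = 1")
    case True
    then have [simp]: "J = {}" using J by simp
    obtain v :: 'v where "v \<in> Basis" using nonempty_Basis by blast
    then have v: "v \<noteq> 0" by (rule nonzero_Basis)
    have single: "\<exists>j. cells I x = {j}" if "x \<noteq> 0" for x
    proof -
      have "card (cells I x) \<le> 1" "card (cells I x) \<noteq> 0"
        using generic[OF that] True tiling_cover[OF tiling] finite_cells[OF tiling] by auto
      then have "card (cells I x) = 1" by linarith
      then show ?thesis by (simp add: card_1_singleton_iff)
    qed
    obtain j\<^sub>1 j\<^sub>2 where j: "cells I v = {j\<^sub>1}" "cells I (- v) = {j\<^sub>2}"
      using single v by (metis neg_equal_0_iff_equal)
    have "j\<^sub>1 \<noteq> j\<^sub>2"
    proof
      assume "j\<^sub>1 = j\<^sub>2"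
      then have "cells I v = I" using not_cells_uminus[OF tiling, of v] j by auto
      then show False using card_gt True j by (metis card_1_singleton_iff less_irrefl One_nat_def)
    qed
    moreover have "?V = {j\<^sub>1, j\<^sub>2}"
    proof (intro subset_antisym subsetI)
      fix j assume "j \<in> ?V"
      then obtain x where x: "x \<noteq> 0" "cells I x = {j}" by auto
      have "dim {v} = DIM('v)" using v True by simp
      then have "span {v} = UNIV" using dim_eq_full by blast
      then obtain c where c: "x = c *\<^sub>R v" by (metis UNIV_I rangeE span_singleton)
      then have "c > 0 \<or> c < 0" using x by auto
      then show "j \<in> {j\<^sub>1, j\<^sub>2}"
        using x j c cells_scale[of c I v] cells_scale[of "- c" I "- v"] by auto
    next
      fix j assume "j \<in> {j\<^sub>1, j\<^sub>2}"
      moreover have "j\<^sub>1 \<in> I" "j\<^sub>2 \<in> I" using j cells_subset by blast+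
      moreover have "- v \<noteq> 0" using v by simp
      ultimately show "j \<in> ?V" using j v by (auto intro: exI[of _ v] exI[of _ "- v"])
    qed
    ultimately show ?thesis by simp
  next
    case False
    \<comment> \<open>At a vertex the local tiling has \<open>DIM('v)\<close> cells and lineality of
      dimension 1, so \<open>cells_omitting_one\<close> would give a nearby point with exactly the
      cells \<open>J\<close>.\<close>
    have "?V = {}"
    proof (rule ccontr)
      assume "?V \<noteq> {}"
      then obtain j v where v: "j \<in> I - J" "v \<noteq> 0" "cells I v = insert j J" by blast
      then have c: "card (cells I v) = DIM('v)" using J by simp
      have "lineality (cells I v) = span {v}"
      proof
        show "lineality (cells I v) \<subseteq> span {v}" using vertex_lineality[OF c] by blast
        show "span {v} \<subseteq> lineality (cells I v)"
          using mem_lineality[of "cells I v" I v] by (intro span_minimal subspace_lineality) auto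
      qed
      then have d: "dim (lineality (cells I v)) = 1" using v(2) by simp
      have "card (cells I v) \<ge> 2" using c False DIM_positive[where 'a='v] by linarith
      then obtain w where w: "cells (cells I v) w = cells I v - {j}"
        using cells_omitting_one[OF tiling_cells[OF tiling, of v], of j] c d v(3) by auto
      obtain t where "cells I (v + t *\<^sub>R w) = cells (cells I v) w"
        using cells_ray[OF tiling] .
      then show False using w nz v by auto
    qed
    then show ?thesis by (simp only: card.empty even_zero)
  qed
qed

end
section \<open>The trace of a cochain map modulo 2\<close>

text \<open>Both sums run over the inclusions of a set in one with one more element; this moves the
  coboundary from one factor of a matrix product to the other.\<close>

lemma sum_insert_swap:
  fixes f :: "'k::finite set \<Rightarrow> 'k \<Rightarrow> 'a::comm_monoid_add"
  shows "(\<Sum>T\<in>UNIV. \<Sum>l\<in>T. f T l) = (\<Sum>T\<in>UNIV. \<Sum>l\<in>-T. f (insert l T) l)"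
proof -
  have "(\<Sum>T\<in>UNIV. \<Sum>l\<in>T. f T l) = (\<Sum>(T, l)\<in>(SIGMA T:UNIV. T). f T l)"
    by (simp add: sum.Sigma)
  also have "\<dots> = (\<Sum>(T, l)\<in>(SIGMA T:UNIV. - T). f (insert l T) l)"
    by (rule sum.reindex_bij_witness[where i="\<lambda>(T, l). (insert l T, l)" and j="\<lambda>(T, l). (T - {l}, l)"])
      (auto simp: insert_absorb)
  also have "\<dots> = (\<Sum>T\<in>UNIV. \<Sum>l\<in>-T. f (insert l T) l)"
    by (simp add: sum.Sigma)
  finally show ?thesis .
qed

text \<open>
  A cochain map modulo 2 of the augmented cochain complex of the full simplex has trace 0: this
  complex is contractible, the map \<open>S \<mapsto> S - {\<kappa>}\<close> for \<open>\<kappa> \<in> S\<close> being a contracting homotopy.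
\<close>

lemma even_trace:
  fixes F :: "'k::finite set \<Rightarrow> 'k set \<Rightarrow> int"
  assumes "\<And>S S'. even ((\<Sum>k\<in>-S'. F S (insert k S')) + (\<Sum>k\<in>S. F (S - {k}) S'))"
  shows "even (\<Sum>S\<in>UNIV. F S S)"
proof -
  \<comment> \<open>An arbitrary element serves as apex of the contraction. \<open>X\<close> and
    \<open>Y\<close> collect the off-diagonal terms of the hypothesis at
    \<open>insert \<kappa> S\<close> and \<open>S\<close>.\<close>
  obtain \<kappa> :: 'k where True by blast
  define U where "U = {S. \<kappa> \<notin> S}"
  define X where "X S = (\<Sum>k\<in>-insert \<kappa> S. F (insert \<kappa> S) (insert k S))" for S
  define Y where "Y S = (\<Sum>k\<in>S. F (insert \<kappa> S - {k}) S)" for S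
  have UNIV: "UNIV = U \<union> insert \<kappa> ` U"
  proof -
    have "S \<in> U \<union> insert \<kappa> ` U" for S
      by (cases "\<kappa> \<in> S") (auto simp: U_def image_iff intro: exI[of _ "S - {\<kappa>}"])
    then show ?thesis by blast
  qed
  have inj: "inj_on (insert \<kappa>) U" by (auto simp: inj_on_def U_def)
  have "(\<Sum>S\<in>UNIV. F S S) = (\<Sum>S\<in>U. F S S) + (\<Sum>S\<in>insert \<kappa> ` U. F S S)"
    unfolding UNIV by (rule sum.union_disjoint) (auto simp: U_def)
  also have "(\<Sum>S\<in>insert \<kappa> ` U. F S S) = (\<Sum>S\<in>U. F (insert \<kappa> S) (insert \<kappa> S))"
    by (simp add: sum.reindex[OF inj])
  finally have tr: "(\<Sum>S\<in>UNIV. F S S) = (\<Sum>S\<in>U. F S S + F (insert \<kappa> S) (insert \<kappa> S))"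
    by (simp add: sum.distrib)
  have "even (\<Sum>S\<in>U. (F S S + F (insert \<kappa> S) (insert \<kappa> S)) + (X S + Y S))"
  proof (rule dvd_sum)
    fix S assume "S \<in> U"
    then have S: "\<kappa> \<notin> S" by (simp add: U_def)
    then have "- S = insert \<kappa> (- insert \<kappa> S)" by blast
    then have "(\<Sum>k\<in>-S. F (insert \<kappa> S) (insert k S)) = F (insert \<kappa> S) (insert \<kappa> S) + X S"
      unfolding X_def by (metis ComplD finite insertI1 sum.insert)
    moreover have "(\<Sum>k\<in>insert \<kappa> S. F (insert \<kappa> S - {k}) S) = F S S + Y S"
      using S by (simp add: Y_def)
    ultimately show "even ((F S S + F (insert \<kappa> S) (insert \<kappa> S)) + (X S + Y S))"
      using assms[of "insert \<kappa> S" S] by (simp add: algebra_simps)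
  qed
  \<comment> \<open>Moving \<open>k\<close> into \<open>S\<close> matches the two kinds of
    off-diagonal terms, so together they contribute an even number and only the trace
    remains.\<close>
  moreover have "(\<Sum>S\<in>U. X S) = (\<Sum>S\<in>U. Y S)"
  proof -
    have *: "insert \<kappa> (insert k S) - {k} = insert \<kappa> S" if "k \<notin> S" "k \<noteq> \<kappa>" for S k
      using that by auto
    have "(\<Sum>S\<in>U. X S) = (\<Sum>(S, k)\<in>(SIGMA S:U. - insert \<kappa> S). F (insert \<kappa> S) (insert k S))"
      unfolding X_def by (simp add: sum.Sigma)
    also have "\<dots> = (\<Sum>(S, k)\<in>(SIGMA S:U. S). F (insert \<kappa> S - {k}) S)"
      by (rule sum.reindex_bij_witness[where j="\<lambda>(S, k). (insert k S, k)" and i="\<lambda>(S, k). (S - {k}, k)"])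
        (auto simp: U_def insert_absorb, metis *)
    also have "\<dots> = (\<Sum>S\<in>U. Y S)"
      unfolding Y_def by (simp add: sum.Sigma)
    finally show ?thesis .
  qed
  ultimately show ?thesis unfolding tr by (simp add: sum.distrib)
qed

text \<open>The 0-1 matrices of \<open>P\<close> and \<open>Q\<close> are cochain maps modulo 2,
  hence so is their product, whose trace is the number of pairs.\<close>

lemma even_card_compatible_pairs:
  fixes P :: "'k::finite set \<Rightarrow> 'l::finite set \<Rightarrow> bool" and Q :: "'l set \<Rightarrow> 'k set \<Rightarrow> bool"
  assumes P: "\<And>S T. even (card {l \<in> -T. P S (insert l T)} + card {k \<in> S. P (S - {k}) T})"
    and Q: "\<And>T S. even (card {k \<in> -S. Q T (insert k S)} + card {l \<in> T. Q (T - {l}) S})"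
  shows "even (card {(S, T). P S T \<and> Q T S})"
proof -
  define p :: "'k set \<Rightarrow> 'l set \<Rightarrow> int" where "p S T = of_bool (P S T)" for S T
  define q :: "'l set \<Rightarrow> 'k set \<Rightarrow> int" where "q T S = of_bool (Q T S)" for S T
  have Collect_restrict: "{x \<in> A. R x} = A \<inter> {x. R x}" for A :: "'c set" and R by blast
  have p: "even ((\<Sum>l\<in>-T. p S (insert l T)) + (\<Sum>k\<in>S. p (S - {k}) T))" for S T
    using P[of T S, unfolded Collect_restrict] by (simp add: p_def)
  have q: "even ((\<Sum>k\<in>-S. q T (insert k S)) + (\<Sum>l\<in>T. q (T - {l}) S))" for S T
    using Q[of S T, unfolded Collect_restrict] by (simp add: q_def)
  have "even (\<Sum>S\<in>UNIV. \<Sum>T\<in>UNIV. p S T * q T S)"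
  proof (rule even_trace[where F="\<lambda>S S'. \<Sum>T\<in>UNIV. p S T * q T S'"])
    fix S S' :: "'k set"
    \<comment> \<open>The middle term, with the coboundary between the two factors. Added to one sum
      it gives an even number by \<open>q\<close>, added to the other by \<open>p\<close>, and it
      cancels modulo 2.\<close>
    define C where "C = (\<Sum>T\<in>UNIV. \<Sum>l\<in>T. p S T * q (T - {l}) S')"
    have C: "C = (\<Sum>T\<in>UNIV. \<Sum>l\<in>-T. p S (insert l T) * q T S')"
      unfolding C_def by (subst sum_insert_swap) simp
    have "(\<Sum>k\<in>-S'. \<Sum>T\<in>UNIV. p S T * q T (insert k S')) + C
        = (\<Sum>T\<in>UNIV. p S T * ((\<Sum>k\<in>-S'. q T (insert k S')) + (\<Sum>l\<in>T. q (T - {l}) S')))"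
      unfolding C_def
      by (subst sum.swap) (simp add: sum.distrib sum_distrib_left distrib_left)
    moreover have "C + (\<Sum>k\<in>S. \<Sum>T\<in>UNIV. p (S - {k}) T * q T S')
        = (\<Sum>T\<in>UNIV. ((\<Sum>l\<in>-T. p S (insert l T)) + (\<Sum>k\<in>S. p (S - {k}) T)) * q T S')"
      unfolding C sum.swap[of _ UNIV S]
      by (simp add: sum.distrib sum_distrib_right distrib_right)
    moreover have "even (\<Sum>T\<in>UNIV. p S T * ((\<Sum>k\<in>-S'. q T (insert k S')) + (\<Sum>l\<in>T. q (T - {l}) S')))"
      using q by (intro dvd_sum dvd_mult)
    moreover have "even (\<Sum>T\<in>UNIV. ((\<Sum>l\<in>-T. p S (insert l T)) + (\<Sum>k\<in>S. p (S - {k}) T)) * q T S')"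
      using p by (intro dvd_sum dvd_mult2)
    ultimately show "even ((\<Sum>k\<in>-S'. \<Sum>T\<in>UNIV. p S T * q T (insert k S'))
        + (\<Sum>k\<in>S. \<Sum>T\<in>UNIV. p (S - {k}) T * q T S'))"
      by presburger
  qed
  also have "(\<Sum>S\<in>UNIV. \<Sum>T\<in>UNIV. p S T * q T S)
      = (\<Sum>x\<in>UNIV \<times> UNIV. of_bool (P (fst x) (snd x) \<and> Q (snd x) (fst x)))"
    unfolding sum.cartesian_product by (rule sum.cong) (auto simp: p_def q_def)
  also have "\<dots> = int (card {(S, T). P S T \<and> Q T S})"
  proof -
    have "{(S, T). P S T \<and> Q T S} = {x. P (fst x) (snd x) \<and> Q (snd x) (fst x)}" by auto
    then show ?thesis by simp
  qed
  finally show ?thesis by simp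
qed

section \<open>The tiling of a generic complex\<close>

text \<open>Hyperplanes separating the disjoint interiors also separate the closures, and they pass
  through 0 because all cones contain 0.\<close>

lemma separating_vectors_of_cones:
  fixes D :: "'i::finite \<Rightarrow> 'v::euclidean_space set"
  assumes D: "\<And>i. closed (D i)" "\<And>i. convex (D i)" "\<And>i. conic (D i)"
    and int: "\<And>i. interior (D i) \<noteq> {}"
    and disj: "\<And>i j. i \<noteq> j \<Longrightarrow> interior (D i) \<inter> interior (D j) = {}"
    and cover: "(\<Union>i. D i) = UNIV"
  obtains a where "separating_vectors a" "separating_vectors.tiling a UNIV"
    "\<And>z. separating_vectors.cells a UNIV z = {i. z \<in> D i}"
proof -
  have sep: "\<exists>s. s \<noteq> 0 \<and> (\<forall>x\<in>D i. 0 \<le> s \<bullet> x) \<and> (\<forall>x\<in>D j. s \<bullet> x \<le> 0)" if ij: "i \<noteq> j" for i j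
  proof -
    obtain s b where s: "s \<noteq> 0" "\<forall>x\<in>interior (D j). s \<bullet> x \<le> b" "\<forall>x\<in>interior (D i). b \<le> s \<bullet> x"
      using separating_hyperplane_sets[of "interior (D j)" "interior (D i)"] D int disj[OF ij]
      by (auto simp: convex_interior Int_commute)
    have cl: "D i = closure (interior (D i))" for i
      using D int by (simp add: convex_closure_interior closure_closed)
    have 0: "0 \<in> D i" for i
    proof -
      obtain x where "x \<in> D i" using int interior_subset by blast
      then show ?thesis using D(3)[of i] unfolding conic_def by (metis order_refl scaleR_zero_left)
    qed
    have "closure (interior (D j)) \<subseteq> {x. s \<bullet> x \<le> b}"
      using s by (intro closure_minimal closed_halfspace_le) auto
    moreover have "closure (interior (D i)) \<subseteq> {x. s \<bullet> x \<ge> b}"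
      using s by (intro closure_minimal closed_halfspace_ge) auto
    ultimately have le: "D j \<subseteq> {x. s \<bullet> x \<le> b}" "D i \<subseteq> {x. s \<bullet> x \<ge> b}"
      using cl by blast+
    then have "b = 0" using 0[of i] 0[of j] by fastforce
    with s(1) le show ?thesis by (intro exI[of _ s]) auto
  qed
  then have "\<exists>s. \<forall>i j. i \<noteq> j \<longrightarrow>
      s i j \<noteq> 0 \<and> (\<forall>x\<in>D i. 0 \<le> s i j \<bullet> x) \<and> (\<forall>x\<in>D j. s i j \<bullet> x \<le> 0)"
    by metis
  then obtain s where s: "\<And>i j. i \<noteq> j \<Longrightarrow> s i j \<noteq> 0"
    "\<And>i j x. i \<noteq> j \<Longrightarrow> x \<in> D i \<Longrightarrow> 0 \<le> s i j \<bullet> x"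
    "\<And>i j x. i \<noteq> j \<Longrightarrow> x \<in> D j \<Longrightarrow> s i j \<bullet> x \<le> 0"
    by metis
  \<comment> \<open>The choices for \<open>(i, j)\<close> and \<open>(j, i)\<close> are unrelated;
    their difference is antisymmetric and still separates.\<close>
  define a where "a i j = s i j - s j i" for i j
  interpret separating_vectors a by standard (simp add: a_def)
  have pos: "0 \<le> a i j \<bullet> x" if "x \<in> D i" for i j x
  proof (cases "i = j")
    case False
    then show ?thesis using s(2)[of i j x] s(3)[of j i x] that by (simp add: a_def inner_diff_left)
  qed simp
  have strict: "0 < a i j \<bullet> x" if x: "x \<in> interior (D i)" and ij: "i \<noteq> j" for i j x
  proof -
    have "D i \<subseteq> {x. s i j \<bullet> x \<ge> 0}" using s(2) ij by auto
    then have "x \<in> interior {x. s i j \<bullet> x \<ge> 0}" using x interior_mono by blast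
    then have "0 < s i j \<bullet> x" using s(1)[OF ij] by (simp add: interior_halfspace_ge)
    moreover have "s j i \<bullet> x \<le> 0" using s(3)[of j i x] ij x interior_subset by auto
    ultimately show ?thesis by (simp add: a_def inner_diff_left)
  qed
  \<comment> \<open>Pushing \<open>z\<close> along an interior point of \<open>D i\<close> makes
    every inequality strict, so only \<open>D i\<close> can cover the pushed points; closedness then
    gives \<open>z\<close>.\<close>
  have "z \<in> D i" if z: "\<And>j. 0 \<le> a i j \<bullet> z" for i z
  proof -
    obtain x where x: "x \<in> interior (D i)" using int by blast
    have ev: "\<forall>\<^sub>F t in at_right 0. z + t *\<^sub>R x \<in> D i"
      using eventually_at_right_less[of 0]
    proof eventually_elim
      case (elim t)
      obtain j where j: "z + t *\<^sub>R x \<in> D j" using cover by blast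
      have "j = i"
      proof (rule ccontr)
        assume "j \<noteq> i"
        then have "0 < a i j \<bullet> (z + t *\<^sub>R x)"
          using strict[OF x, of j] z[of j] elim by (simp add: inner_right_distrib add_nonneg_pos)
        then show False using pos[OF j, of i] inner_antisym[of i j "z + t *\<^sub>R x"] by linarith
      qed
      with j show ?case by simp
    qed
    have "((\<lambda>t. z + t *\<^sub>R x) \<longlongrightarrow> z + 0 *\<^sub>R x) (at_right (0::real))"
      by (intro tendsto_intros)
    then have "z + 0 *\<^sub>R x \<in> D i"
      by (rule Lim_in_closed_set[OF D(1) ev, rotated]) (simp add: trivial_limit_at_right_real)
    then show ?thesis by simp
  qed
  then have cells: "cells UNIV z = {i. z \<in> D i}" for z
    using pos by (auto simp: cells_def)
  have "tiling UNIV"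
    unfolding tiling_def
  proof (intro conjI allI ballI)
    show "cells UNIV z \<noteq> {}" for z using cover by (auto simp: cells)
    fix i
    obtain x where "x \<in> interior (D i)" using int by blast
    then show "\<exists>z. \<forall>j\<in>UNIV - {i}. 0 < a i j \<bullet> z" using strict by (intro exI[of _ x]) auto
  qed simp
  with that separating_vectors_axioms cells show ?thesis by blast
qed

text \<open>
  The cones over the sets \<open>C l\<close> fill the positive orthant. Its complement is filled by one cone
  for each coordinate \<open>k\<close>, such that a point of the simplex lies in this cone iff its coordinate \<open>k\<close> vanishes.
\<close>

definition homogenized :: "('l \<Rightarrow> (real ^ 'k) set) \<Rightarrow> 'k + 'l \<Rightarrow> (real ^ 'k) set" where
  "homogenized C i =
     (case i of Inl k \<Rightarrow> {z. z $ k \<le> 0 \<and> (\<forall>j. z $ k \<le> z $ j)} | Inr l \<Rightarrow> conic hull (C l))"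

lemma total_eq_inner: "(\<Sum>k\<in>UNIV. z $ k) = 1 \<bullet> (z :: real ^ 'k::finite)"
  by (simp add: inner_vec_def)

lemma affine_hull_prob_simplex:
  "affine hull (prob_simplex :: (real ^ 'k::finite) set) = {z. 1 \<bullet> z = 1}"
proof
  show "affine hull (prob_simplex :: (real ^ 'k) set) \<subseteq> {z. 1 \<bullet> z = 1}"
    by (rule hull_minimal) (auto simp: prob_simplex_def total_eq_inner affine_hyperplane)
  show "{z. 1 \<bullet> z = 1} \<subseteq> affine hull (prob_simplex :: (real ^ 'k) set)"
  proof
    fix z :: "real ^ 'k" assume z: "z \<in> {z. 1 \<bullet> z = 1}"
    define e :: "'k \<Rightarrow> real ^ 'k" where "e k = axis k 1" for k
    have inj: "inj e" by (auto simp: inj_def e_def axis_eq_axis)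
    have "(\<Sum>v\<in>range e. z \<bullet> v) = (\<Sum>k\<in>UNIV. z $ k)"
      unfolding sum.reindex[OF inj] by (simp add: e_def inner_axis)
    then have "(\<Sum>v\<in>range e. z \<bullet> v) = 1"
      using z by (simp add: total_eq_inner)
    moreover have "(\<Sum>v\<in>range e. (z \<bullet> v) *\<^sub>R v) = z"
      unfolding sum.reindex[OF inj]
      by (simp add: e_def inner_axis vec_eq_iff) (simp add: axis_def if_distrib cong: if_cong)
    ultimately have "z \<in> affine hull (range e)"
      by (subst affine_hull_finite) auto
    moreover have "range e \<subseteq> prob_simplex"
      by (auto simp: prob_simplex_def e_def axis_def)
    ultimately show "z \<in> affine hull prob_simplex" using hull_mono by blast
  qed
qed

lemma disjoint_interiors:
  fixes b :: "'v::euclidean_space"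
  assumes "S \<inter> T \<subseteq> {z. b \<bullet> z = 0}" "b \<noteq> 0"
  shows "interior S \<inter> interior T = {}"
proof -
  have "interior (S \<inter> T) = {}"
    using interior_mono[OF assms(1)] interior_hyperplane[OF assms(2)] by blast
  then show ?thesis by simp
qed

lemma normalized_in_simplex:
  fixes z :: "real ^ 'k::finite"
  assumes "z \<noteq> 0" "\<forall>k. 0 \<le> z $ k"
  shows "1 \<bullet> z > 0" "(1 / (1 \<bullet> z)) *\<^sub>R z \<in> prob_simplex"
proof -
  obtain k where "z $ k \<noteq> 0" using assms(1) by (auto simp: vec_eq_iff)
  then have "0 < z $ k" using assms(2) by (simp add: less_le)
  then show pos: "1 \<bullet> z > 0"
    unfolding total_eq_inner[symmetric] using assms by (intro sum_pos2[of _ k]) auto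
  then show "(1 / (1 \<bullet> z)) *\<^sub>R z \<in> prob_simplex"
    using assms by (simp add: prob_simplex_def total_eq_inner flip: sum_distrib_left sum_divide_distrib)
qed

context
  fixes C :: "'l::finite \<Rightarrow> (real ^ 'k::finite) set"
  assumes generic: "generic_complex C"
begin

lemma complex_subset: "C l \<subseteq> prob_simplex"
  using generic by (auto simp: generic_complex_def polytopial_complex_def)

text \<open>Points of the simplex have coordinate sum 1, so the factor scaling a point of
  \<open>C l\<close> to \<open>z\<close> can only be \<open>1 \<bullet> z\<close>.\<close>

lemma mem_conic_hull_complex:
  assumes "z \<noteq> 0"
  shows "z \<in> conic hull (C l) \<longleftrightarrow> (\<forall>k. 0 \<le> z $ k) \<and> (1 / (1 \<bullet> z)) *\<^sub>R z \<in> C l"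
proof
  assume "z \<in> conic hull (C l)"
  then obtain c x where x: "c \<ge> 0" "x \<in> C l" "z = c *\<^sub>R x" by (auto simp: conic_hull_explicit)
  then have s: "x \<in> prob_simplex" using complex_subset by blast
  then have "1 \<bullet> z = c" using x(3) by (simp add: prob_simplex_def total_eq_inner)
  moreover have "c \<noteq> 0" using assms x by auto
  ultimately show "(\<forall>k. 0 \<le> z $ k) \<and> (1 / (1 \<bullet> z)) *\<^sub>R z \<in> C l"
    using x s by (auto simp: prob_simplex_def)
next
  assume z: "(\<forall>k. 0 \<le> z $ k) \<and> (1 / (1 \<bullet> z)) *\<^sub>R z \<in> C l"
  then have "0 \<le> 1 \<bullet> z" by (auto simp flip: total_eq_inner intro: sum_nonneg)
  moreover have "1 \<bullet> z \<noteq> 0"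
  proof
    assume "1 \<bullet> z = 0"
    \<comment> \<open>Division by zero gives 0, so the normalized point would be the origin.\<close>
    then have "0 \<in> C l" using z by simp
    then have "0 \<in> (prob_simplex :: (real ^ 'k) set)" using complex_subset by blast
    then show False by (simp add: prob_simplex_def)
  qed
  ultimately have "(1 \<bullet> z) *\<^sub>R ((1 / (1 \<bullet> z)) *\<^sub>R z) \<in> conic hull (C l)"
    using z unfolding conic_hull_explicit by blast
  then show "z \<in> conic hull (C l)" using \<open>1 \<bullet> z \<noteq> 0\<close> by simp
qed

lemma homogenized_nonneg:
  assumes "z \<noteq> 0" "\<forall>k. 0 \<le> z $ k"
  shows "{i. z \<in> homogenized C i} = Inl ` {k. z $ k = 0} \<union> Inr ` {l. (1 / (1 \<bullet> z)) *\<^sub>R z \<in> C l}"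
proof (intro set_eqI)
  fix i
  show "i \<in> {i. z \<in> homogenized C i} \<longleftrightarrow>
      i \<in> Inl ` {k. z $ k = 0} \<union> Inr ` {l. (1 / (1 \<bullet> z)) *\<^sub>R z \<in> C l}"
  proof (cases i)
    case (Inl k)
    then show ?thesis using assms by (auto simp: homogenized_def intro: antisym)
  next
    case (Inr l)
    then show ?thesis using assms mem_conic_hull_complex by (auto simp: homogenized_def)
  qed
qed

lemma homogenized_simplex:
  assumes "q \<in> prob_simplex"
  shows "{i. q \<in> homogenized C i} = Inl ` {k. q $ k = 0} \<union> Inr ` {l. q \<in> C l}"
proof -
  have "1 \<bullet> q = 1" using assms by (simp add: prob_simplex_def total_eq_inner)
  moreover from this have "q \<noteq> 0" by auto
  ultimately show ?thesis using homogenized_nonneg[of q] assms by (simp add: prob_simplex_def)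
qed

lemma homogenized_closed: "closed (homogenized C i)"
proof (cases i)
  case (Inl k)
  then show ?thesis
    by (auto simp: homogenized_def intro!: closed_Collect_conj closed_Collect_all closed_Collect_le continuous_intros)
next
  case (Inr l)
  have "polytope (C l)" using generic by (auto simp: generic_complex_def polytopial_complex_def)
  then show ?thesis
    using Inr polyhedron_conic_hull_polytope polyhedron_imp_closed by (auto simp: homogenized_def)
qed

lemma homogenized_convex: "convex (homogenized C i)"
proof (cases i)
  case (Inl k)
  then show ?thesis
    by (auto simp: homogenized_def convex_def intro!: add_nonpos_nonpos add_mono mult_left_mono mult_nonneg_nonpos)
next
  case (Inr l)
  have "polytope (C l)" using generic by (auto simp: generic_complex_def polytopial_complex_def)
  then show ?thesis
    using Inr by (auto simp: homogenized_def intro: convex_conic_hull polytope_imp_convex)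
qed

lemma homogenized_conic: "conic (homogenized C i)"
proof (cases i)
  case (Inl k)
  then show ?thesis
    by (auto simp: homogenized_def conic_def intro!: mult_left_mono mult_nonneg_nonpos)
next
  case (Inr l)
  then show ?thesis by (simp add: homogenized_def conic_conic_hull)
qed

lemma homogenized_cover: "(\<Union>i. homogenized C i) = UNIV"
proof -
  have "\<exists>i. z \<in> homogenized C i" for z
  proof (cases "\<forall>k. 0 \<le> z $ k")
    case True
    show ?thesis
    proof (cases "z = 0")
      case True
      then have "z \<in> homogenized C (Inl undefined)" by (simp add: homogenized_def)
      then show ?thesis by blast
    next
      case False
      have "(\<Union>l. C l) = prob_simplex"
        using generic by (simp add: generic_complex_def polytopial_complex_def)
      then obtain l where "(1 / (1 \<bullet> z)) *\<^sub>R z \<in> C l"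
        using normalized_in_simplex[OF False True] by blast
      then have "z \<in> homogenized C (Inr l)"
        using mem_conic_hull_complex[OF False] True by (simp add: homogenized_def)
      then show ?thesis by blast
    qed
  next
    case False
    \<comment> \<open>A point with a negative coordinate belongs to the cone of any coordinate at
      which it is smallest.\<close>
    define m where "m = Min (range (\<lambda>k. z $ k))"
    have "m \<in> range (\<lambda>k. z $ k)" and m: "m \<le> z $ k" for k
      unfolding m_def by (auto intro: Min_in)
    then obtain k where "m = z $ k" by blast
    moreover from False obtain k' where "z $ k' < 0" by (auto simp: not_le)
    ultimately have "z $ k \<le> 0" using m[of k'] by linarith
    then have "z \<in> homogenized C (Inl k)"
      using m \<open>m = z $ k\<close> by (simp add: homogenized_def)
    then show ?thesis by blast
  qed
  then show ?thesis by blast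
qed

lemma homogenized_interior: "interior (homogenized C i) \<noteq> {}"
proof (cases i)
  case (Inl k)
  define U where "U = {z :: real ^ 'k. z $ k < 0} \<inter> (\<Inter>j\<in>-{k}. {z. z $ k < z $ j})"
  have "open U"
    unfolding U_def by (intro open_Int open_INT ballI open_Collect_less continuous_intros) auto
  moreover have "U \<subseteq> homogenized C i"
  proof
    fix z assume "z \<in> U"
    then have "z $ k < 0" "z $ k < z $ j" if "j \<noteq> k" for j using that by (auto simp: U_def)
    then have "z $ k \<le> z $ j" for j by (cases "j = k") (auto intro: less_imp_le)
    with \<open>z \<in> U\<close> show "z \<in> homogenized C i" using Inl by (auto simp: homogenized_def U_def)
  qed
  moreover have "- axis k 1 \<in> U" by (auto simp: U_def axis_def)
  ultimately show ?thesis using interior_maximal by blast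
next
  case (Inr l)
  have "simplex_interior (C l) \<noteq> {}"
    using generic by (auto simp: generic_complex_def polytopial_complex_def)
  then obtain U x where U: "open U" "x \<in> {z. 1 \<bullet> z = 1} \<inter> U" "{z. 1 \<bullet> z = 1} \<inter> U \<subseteq> C l"
    unfolding simplex_interior_def interior_of_def affine_hull_prob_simplex
    by (auto simp: openin_open)
  \<comment> \<open>Radial projection pulls the relatively open piece of the hyperplane back to an
    open set of the space.\<close>
  let ?f = "\<lambda>z :: real ^ 'k. (1 / (1 \<bullet> z)) *\<^sub>R z"
  define V where "V = {z :: real ^ 'k. 1 \<bullet> z > 0} \<inter> ?f -` U"
  have "open V"
    unfolding V_def
  proof (rule continuous_open_preimage)
    show "continuous_on {z :: real ^ 'k. 1 \<bullet> z > 0} ?f"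
      by (intro continuous_intros) auto
  qed (auto intro: U open_halfspace_gt)
  moreover have "V \<subseteq> homogenized C i"
  proof
    fix z assume z: "z \<in> V"
    then have "?f z \<in> C l" "0 \<le> 1 \<bullet> z" using U(3) by (auto simp: V_def)
    then have "(1 \<bullet> z) *\<^sub>R ?f z \<in> conic hull (C l)"
      unfolding conic_hull_explicit by blast
    then show "z \<in> homogenized C i" using z Inr by (simp add: homogenized_def V_def)
  qed
  moreover have "x \<in> V" using U by (simp add: V_def)
  ultimately show ?thesis using interior_maximal by blast
qed

lemma homogenized_disjoint:
  assumes "i \<noteq> j"
  shows "interior (homogenized C i) \<inter> interior (homogenized C j) = {}"
proof -
  have mixed: "interior (homogenized C (Inl k)) \<inter> interior (homogenized C (Inr l)) = {}" for k l
  proof -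
    have "z $ k = 0" if "z \<in> homogenized C (Inl k)" "z \<in> homogenized C (Inr l)" for z
    proof (cases "z = 0")
      case False
      then show ?thesis
        using that mem_conic_hull_complex[OF False] by (auto simp: homogenized_def intro: antisym)
    qed simp
    then have "homogenized C (Inl k) \<inter> homogenized C (Inr l) \<subseteq> {z. axis k 1 \<bullet> z = 0}"
      by (auto simp: inner_axis')
    then show ?thesis by (rule disjoint_interiors) (simp add: axis_eq_0_iff)
  qed
  consider k k' where "i = Inl k" "j = Inl k'" | k l where "i = Inl k" "j = Inr l"
    | k l where "i = Inr l" "j = Inl k" | l l' where "i = Inr l" "j = Inr l'"
    by (cases i; cases j) auto
  then show ?thesis
  proof cases
    case 1
    let ?b = "axis k 1 - axis k' 1 :: real ^ 'k"
    have "homogenized C i \<inter> homogenized C j \<subseteq> {z. ?b \<bullet> z = 0}"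
      using 1 by (auto simp: homogenized_def inner_diff_left inner_axis' intro: antisym)
    moreover have "?b \<noteq> 0" using 1 assms by (auto simp: axis_eq_axis)
    ultimately show ?thesis by (rule disjoint_interiors)
  next
    case 2
    then show ?thesis using mixed by simp
  next
    case 3
    then show ?thesis using mixed by (simp add: Int_commute)
  next
    case 4
    then have ne: "l \<noteq> l'" using assms by simp
    let ?W = "interior (homogenized C i) \<inter> interior (homogenized C j)"
    show ?thesis
    proof (rule ccontr)
      assume "?W \<noteq> {}"
      then obtain x where x: "x \<in> ?W" by blast
      have nonneg: "homogenized C i \<subseteq> {z. 0 \<le> 1 \<bullet> z}"
      proof
        fix z assume z: "z \<in> homogenized C i"
        show "z \<in> {z. 0 \<le> 1 \<bullet> z}"
        proof (cases "z = 0")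
          case False
          then show ?thesis
            using z 4 mem_conic_hull_complex[OF False] normalized_in_simplex[OF False]
            by (auto simp: homogenized_def intro: less_imp_le)
        qed simp
      qed
      have "(1 :: real ^ 'k) \<noteq> 0" by simp
      then have c: "1 \<bullet> x > 0"
        using x interior_mono[OF nonneg] interior_halfspace_ge by blast
      \<comment> \<open>Rescaling the hyperplane to the height of \<open>x\<close> turns the common
        interior into a relatively open subset of \<open>C l \<inter> C l'\<close>.\<close>
      define T where "T = {z. 1 \<bullet> z = 1} \<inter> (\<lambda>z. (1 \<bullet> x) *\<^sub>R z) -` ?W"
      have "open ((\<lambda>z. (1 \<bullet> x) *\<^sub>R z) -` ?W)"
        by (intro open_vimage continuous_intros open_Int open_interior)
      then have "openin (top_of_set {z. 1 \<bullet> z = 1}) T"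
        unfolding T_def by (auto simp: openin_open)
      moreover have "(1 / (1 \<bullet> x)) *\<^sub>R x \<in> T" using x c by (simp add: T_def)
      moreover have "T \<subseteq> C l \<inter> C l'"
      proof
        fix z assume z: "z \<in> T"
        then have "(1 \<bullet> x) *\<^sub>R z \<in> conic hull (C l) \<inter> conic hull (C l')"
          using 4 interior_subset by (fastforce simp: T_def homogenized_def)
        moreover have "(1 \<bullet> x) *\<^sub>R z \<noteq> 0" using z c by (auto simp: T_def)
        ultimately show "z \<in> C l \<inter> C l'"
          using z c by (simp add: mem_conic_hull_complex T_def)
      qed
      ultimately have "simplex_interior (C l \<inter> C l') \<noteq> {}"
        unfolding simplex_interior_def interior_of_def affine_hull_prob_simplex by blast
      then show False using generic ne by (auto simp: generic_complex_def polytopial_complex_def)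
    qed
  qed
qed

text \<open>In the orthant the vanishing coordinates number \<open>CARD('k)\<close> minus the size
  of the support, which by genericity bounds the number of labels. Elsewhere only the coordinate
  cones can contain \<open>z\<close>.\<close>

lemma homogenized_card:
  assumes "z \<noteq> 0"
  shows "card {i. z \<in> homogenized C i} \<le> CARD('k)"
proof (cases "\<forall>k. 0 \<le> z $ k")
  case True
  define q where "q = (1 / (1 \<bullet> z)) *\<^sub>R z"
  have q: "q \<in> prob_simplex" and pos: "1 \<bullet> z > 0"
    using normalized_in_simplex[OF assms True] by (auto simp: q_def)
  have "card {i. z \<in> homogenized C i} \<le> card (Inl ` {k. z $ k = 0} :: ('k + 'l) set) + card (Inr ` {l. q \<in> C l} :: ('k + 'l) set)"
    unfolding homogenized_nonneg[OF assms True] q_def by (rule card_Un_le)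
  also have "\<dots> = card {k. q $ k = 0} + card {l. q \<in> C l}"
    using pos by (simp add: card_image q_def)
  also have "\<dots> \<le> card {k. q $ k = 0} + card {k. q $ k \<noteq> 0}"
    using generic q by (auto simp: generic_complex_def)
  also have "\<dots> = card ({k. q $ k = 0} \<union> {k. q $ k \<noteq> 0})"
    by (rule card_Un_disjoint[symmetric]) auto
  also have "{k. q $ k = 0} \<union> {k. q $ k \<noteq> 0} = UNIV" by blast
  finally show ?thesis .
next
  case False
  then have "z \<notin> homogenized C (Inr l)" for l
    using mem_conic_hull_complex[OF assms] by (auto simp: homogenized_def)
  then have "i \<in> range Inl" if "z \<in> homogenized C i" for i
    using that by (cases i) auto
  then have "{i. z \<in> homogenized C i} \<subseteq> range Inl" by blast
  then have "card {i. z \<in> homogenized C i} \<le> card (range Inl :: ('k + 'l) set)"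
    by (intro card_mono) auto
  then show ?thesis by (simp add: card_image)
qed

lemma generic_tiling_homogenized:
  obtains a where "generic_tiling a UNIV"
    "\<And>z. separating_vectors.cells a UNIV z = {i. z \<in> homogenized C i}"
proof -
  obtain a where a: "separating_vectors a" "separating_vectors.tiling a UNIV"
    "\<And>z. separating_vectors.cells a UNIV z = {i. z \<in> homogenized C i}"
    using separating_vectors_of_cones[of "homogenized C"] homogenized_closed homogenized_convex
      homogenized_conic homogenized_interior homogenized_disjoint homogenized_cover by metis
  interpret separating_vectors a by (rule a)
  have "generic_tiling a UNIV"
    by unfold_locales (use a homogenized_card in auto)
  with that a show ?thesis by blast
qed

end

section \<open>Vertices of a generic complex\<close>

text \<open>
  The pair \<open>({}, {})\<close> corresponds to the ray of \<open>- 1\<close>, where all cones of the coordinates meet.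
\<close>

definition vertex :: "('l::finite \<Rightarrow> (real ^ 'k::finite) set) \<Rightarrow> 'k set \<Rightarrow> 'l set \<Rightarrow> bool" where
  "vertex C S T \<longleftrightarrow> card S = card T \<and>
     (S = {} \<or> (\<exists>q\<in>prob_simplex. {k. q $ k \<noteq> 0} = S \<and> {l. q \<in> C l} = T))"

text \<open>A point with a label lies in the orthant and can be normalized to the simplex. Without
  labels, equal cardinality makes both sets empty, which is the artificial vertex.\<close>

lemma vertex_iff_cells:
  assumes C: "generic_complex C" and card: "card S = card T"
  shows "vertex C S T \<longleftrightarrow> (\<exists>z. z \<noteq> 0 \<and> {i. z \<in> homogenized C i} = Inl ` (- S) \<union> Inr ` T)"
    (is "_ \<longleftrightarrow> (\<exists>z. ?R z)")
proof
  assume "vertex C S T"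
  then consider "S = {}" | q where "q \<in> prob_simplex" "{k. q $ k \<noteq> 0} = S" "{l. q \<in> C l} = T"
    by (auto simp: vertex_def)
  then show "\<exists>z. ?R z"
  proof cases
    case 1
    then have "T = {}" using card by simp
    have "(- 1 :: real ^ 'b) \<noteq> 0" by simp
    then have "- 1 \<notin> homogenized C (Inr l)" for l
      using mem_conic_hull_complex[OF C, of "- 1"] by (simp add: homogenized_def)
    moreover have "- 1 \<in> homogenized C (Inl k)" for k by (simp add: homogenized_def)
    ultimately have "(- 1 \<in> homogenized C i) = (i \<in> range Inl)" for i by (cases i) auto
    then have "?R (- 1)" using 1 \<open>T = {}\<close> by auto
    then show ?thesis by blast
  next
    case 2
    then have "- S = {k. q $ k = 0}" by blast
    then have "?R q"
      using homogenized_simplex[OF C 2(1)] 2 by (auto simp: prob_simplex_def)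
    then show ?thesis by blast
  qed
next
  assume "\<exists>z. ?R z"
  then obtain z where z: "z \<noteq> 0" "{i. z \<in> homogenized C i} = Inl ` (- S) \<union> Inr ` T" by blast
  show "vertex C S T"
  proof (cases "T = {}")
    case True
    then show ?thesis using card by (simp add: vertex_def)
  next
    case False
    then obtain l where "l \<in> T" by blast
    then have "z \<in> homogenized C (Inr l)" using z(2) by blast
    then have nonneg: "\<forall>k. 0 \<le> z $ k"
      using mem_conic_hull_complex[OF C z(1)] by (simp add: homogenized_def)
    define q where "q = (1 / (1 \<bullet> z)) *\<^sub>R z"
    have q: "q \<in> prob_simplex" "1 \<bullet> z > 0"
      using normalized_in_simplex[OF z(1) nonneg] by (auto simp: q_def)
    have eq: "Inl ` {k. z $ k = 0} \<union> Inr ` {l. q \<in> C l} = Inl ` (- S) \<union> Inr ` T"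
      using homogenized_nonneg[OF C z(1) nonneg] z(2) by (simp add: q_def)
    then have "k \<in> {k. z $ k = 0} \<longleftrightarrow> k \<in> - S" "l \<in> {l. q \<in> C l} \<longleftrightarrow> l \<in> T" for k l
      by (blast, blast)
    then have "{k. q $ k \<noteq> 0} = S" "{l. q \<in> C l} = T" using q by (auto simp: q_def)
    then show ?thesis using card q by (auto simp: vertex_def)
  qed
qed

text \<open>Such a point lies in as many cells as the dimension, so \<open>vertex_ray\<close> fixes
  its ray and the coordinate sum 1 fixes the scale.\<close>

lemma vertex_unique:
  assumes C: "generic_complex C" and q: "q \<in> prob_simplex" "q' \<in> prob_simplex"
    and card: "card {k. q $ k \<noteq> 0} = card {l. q \<in> C l}"
    and eq: "{k. q $ k \<noteq> 0} = {k. q' $ k \<noteq> 0}" "{l. q \<in> C l} = {l. q' \<in> C l}"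
  shows "q = q'"
proof -
  obtain a where "generic_tiling a UNIV"
    and cells: "\<And>z. separating_vectors.cells a UNIV z = {i. z \<in> homogenized C i}"
    using generic_tiling_homogenized[OF C] by blast
  then interpret generic_tiling a UNIV by simp
  have 1: "1 \<bullet> q = 1" "1 \<bullet> q' = 1" using q by (auto simp: prob_simplex_def total_eq_inner)
  have compl: "{k. q $ k = 0} = - {k. q $ k \<noteq> 0}" "{k. q' $ k = 0} = - {k. q' $ k \<noteq> 0}" by auto
  have "cells UNIV q = cells UNIV q'"
    by (simp only: cells homogenized_simplex[OF C q(1)] homogenized_simplex[OF C q(2)] compl eq)
  moreover have "card (cells UNIV q) = CARD('b)"
  proof -
    have "card (cells UNIV q) = card {k. q $ k = 0} + card {l. q \<in> C l}"
      unfolding cells homogenized_simplex[OF C q(1)]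
      by (subst card_Un_disjoint) (auto simp: card_image)
    also have "\<dots> = card ({k. q $ k = 0} \<union> {k. q $ k \<noteq> 0})"
      unfolding card[symmetric] by (rule card_Un_disjoint[symmetric]) auto
    also have "{k. q $ k = 0} \<union> {k. q $ k \<noteq> 0} = UNIV" by blast
    finally show ?thesis .
  qed
  moreover have "q' \<noteq> 0" using 1 by auto
  ultimately obtain c where "q' = c *\<^sub>R q"
    using vertex_ray[of q q'] by auto
  with 1 show ?thesis by simp
qed

text \<open>This is \<open>even_vertices\<close> read through \<open>vertex_iff_cells\<close>: the
  edge is \<open>- S\<close> together with \<open>T\<close>, and a further cell either adds a label
  to \<open>T\<close> or deletes an element of \<open>S\<close>.\<close>

lemma even_vertices_complex:
  assumes C: "generic_complex C"
  shows "even (card {l \<in> -T. vertex C S (insert l T)} + card {k \<in> S. vertex C (S - {k}) T})"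
proof (cases "card S = card T + 1")
  case False
  then have "\<not> vertex C S (insert l T)" if "l \<notin> T" for l
    using that by (simp add: vertex_def)
  moreover have "\<not> vertex C (S - {k}) T" if "k \<in> S" for k
    using False card_Suc_Diff1[OF _ that] by (auto simp: vertex_def)
  ultimately have "{l \<in> -T. vertex C S (insert l T)} = {}" "{k \<in> S. vertex C (S - {k}) T} = {}"
    by auto
  then show ?thesis by (simp only: card.empty) simp
next
  case True
  obtain a where "generic_tiling a UNIV"
    and cells: "\<And>z. separating_vectors.cells a UNIV z = {i. z \<in> homogenized C i}"
    using generic_tiling_homogenized[OF C] by blast
  then interpret generic_tiling a UNIV by simp
  define J :: "('b + 'a) set" where "J = Inl ` (- S) \<union> Inr ` T"
  have "card J = card (- S) + card T"
    unfolding J_def by (subst card_Un_disjoint) (auto simp: card_image)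
  moreover have "card (- S) + card S = CARD('b)"
    using card_Un_disjoint[of "- S" S] by simp
  ultimately have J: "card J + 1 = DIM(real ^ 'b)" using True by simp
  let ?V = "\<lambda>j. \<exists>v. v \<noteq> 0 \<and> cells UNIV v = insert j J"
  have Inl: "?V (Inl k) \<longleftrightarrow> vertex C (S - {k}) T" if "k \<in> S" for k
  proof -
    have "card (S - {k}) = card T" using True that by simp
    moreover have "insert (Inl k) J = Inl ` (- (S - {k})) \<union> Inr ` T" using that by (auto simp: J_def)
    ultimately show ?thesis by (simp only: vertex_iff_cells[OF C] cells)
  qed
  have Inr: "?V (Inr l) \<longleftrightarrow> vertex C S (insert l T)" if "l \<notin> T" for l
  proof -
    have "card S = card (insert l T)" using True that by simp
    moreover have "insert (Inr l) J = Inl ` (- S) \<union> Inr ` (insert l T)" by (auto simp: J_def)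
    ultimately show ?thesis by (simp only: vertex_iff_cells[OF C] cells)
  qed
  have "{j \<in> UNIV - J. ?V j}
      = Inr ` {l \<in> -T. vertex C S (insert l T)} \<union> Inl ` {k \<in> S. vertex C (S - {k}) T}"
  proof (intro set_eqI)
    fix j
    show "j \<in> {j \<in> UNIV - J. ?V j} \<longleftrightarrow>
        j \<in> Inr ` {l \<in> -T. vertex C S (insert l T)} \<union> Inl ` {k \<in> S. vertex C (S - {k}) T}"
    proof (cases j)
      case (Inl k)
      then have "j \<in> J \<longleftrightarrow> k \<notin> S" by (auto simp: J_def)
      with Inl \<open>\<And>k. k \<in> S \<Longrightarrow> ?V (Inl k) \<longleftrightarrow> vertex C (S - {k}) T\<close> show ?thesis by blast
    next
      case (Inr l)
      then have "j \<in> J \<longleftrightarrow> l \<in> T" by (auto simp: J_def)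
      with Inr \<open>\<And>l. l \<notin> T \<Longrightarrow> ?V (Inr l) \<longleftrightarrow> vertex C S (insert l T)\<close> show ?thesis by blast
    qed
  qed
  moreover have "card (Inr ` {l \<in> -T. vertex C S (insert l T)} \<union> Inl ` {k \<in> S. vertex C (S - {k}) T} :: ('b + 'a) set)
      = card {l \<in> -T. vertex C S (insert l T)} + card {k \<in> S. vertex C (S - {k}) T}"
    by (subst card_Un_disjoint) (auto simp: card_image)
  ultimately show ?thesis using even_vertices[OF J] by simp
qed

section \<open>Fully labelled points\<close>

lemma compatible_payoffs_bdd_below:
  fixes u :: "'a::finite \<Rightarrow> 'b::finite \<Rightarrow> real"
  shows "bdd_below ((\<lambda>U. x \<bullet> U) ` compatible_payoffs u H y)"
proof (rule bdd_belowI)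
  fix t assume "t \<in> (\<lambda>U. x \<bullet> U) ` compatible_payoffs u H y"
  then obtain y' where y': "y' \<in> prob_simplex" and t: "t = x \<bullet> payoff_vector u y'"
    by (auto simp: compatible_payoffs_def)
  \<comment> \<open>Weights in the unit interval bound the payoffs uniformly; a real infimum is a
    guaranteed lower bound only for a set bounded below.\<close>
  have y'01: "0 \<le> y' $ b \<and> y' $ b \<le> 1" for b
  proof -
    have "y' $ b \<le> (\<Sum>b\<in>UNIV. y' $ b)"
      using y' by (intro member_le_sum) (auto simp: prob_simplex_def)
    then show ?thesis using y' by (simp add: prob_simplex_def)
  qed
  have "t = (\<Sum>a\<in>UNIV. \<Sum>b\<in>UNIV. x $ a * (y' $ b * u a b))"
    by (simp add: t payoff_vector_def inner_vec_def sum_distrib_left)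
  also have "\<dots> \<ge> (\<Sum>a\<in>UNIV. \<Sum>b\<in>UNIV. - \<bar>x $ a * u a b\<bar>)"
  proof (intro sum_mono)
    fix a b
    have "\<bar>x $ a * (y' $ b * u a b)\<bar> = y' $ b * \<bar>x $ a * u a b\<bar>"
      using y'01[of b] by (simp add: abs_mult)
    also have "\<dots> \<le> 1 * \<bar>x $ a * u a b\<bar>"
      using y'01[of b] by (intro mult_right_mono) auto
    finally show "- \<bar>x $ a * u a b\<bar> \<le> x $ a * (y' $ b * u a b)" by linarith
  qed
  finally show "(\<Sum>a\<in>UNIV. \<Sum>b\<in>UNIV. - \<bar>x $ a * u a b\<bar>) \<le> t" .
qed

text \<open>The worst payoff is an infimum of functionals linear in the action.\<close>

lemma worst_payoff_concave:
  fixes u :: "'a::finite \<Rightarrow> 'b::finite \<Rightarrow> real"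
  assumes p: "p \<in> prob_simplex" and y: "y \<in> prob_simplex"
  shows "(\<Sum>l\<in>UNIV. p $ l * worst_payoff u H y (xs l)) \<le> worst_payoff u H y (induced_action xs p)"
  unfolding worst_payoff_def[of u H y "induced_action xs p"]
proof (rule cINF_greatest)
  show "compatible_payoffs u H y \<noteq> {}" using y by (auto simp: compatible_payoffs_def)
  fix U assume U: "U \<in> compatible_payoffs u H y"
  have "(\<Sum>l\<in>UNIV. p $ l * worst_payoff u H y (xs l)) \<le> (\<Sum>l\<in>UNIV. p $ l * (xs l \<bullet> U))"
  proof (intro sum_mono mult_left_mono)
    show "worst_payoff u H y (xs l) \<le> xs l \<bullet> U" for l
      unfolding worst_payoff_def by (rule cINF_lower[OF compatible_payoffs_bdd_below U])
  qed (use p in \<open>simp add: prob_simplex_def\<close>)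
  also have "\<dots> = induced_action xs p \<bullet> U"
    by (simp add: induced_action_def inner_sum_left)
  finally show "(\<Sum>l\<in>UNIV. p $ l * worst_payoff u H y (xs l)) \<le> induced_action xs p \<bullet> U" .
qed

lemma induced_action_prob_simplex:
  assumes p: "p \<in> prob_simplex" and xs: "\<And>l. xs l \<in> prob_simplex"
  shows "induced_action xs p \<in> prob_simplex"
proof -
  have "(\<Sum>i\<in>UNIV. \<Sum>l\<in>UNIV. p $ l * xs l $ i) = (\<Sum>l\<in>UNIV. p $ l * (\<Sum>i\<in>UNIV. xs l $ i))"
    by (subst sum.swap) (simp add: sum_distrib_left)
  also have "\<dots> = 1" using p xs by (simp add: prob_simplex_def)
  finally show ?thesis
    using p xs by (auto simp: prob_simplex_def induced_action_def intro!: sum_nonneg)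
qed

text \<open>Maximizers of a concave function are closed under convex combinations, and only indices
  of nonzero weight enter.\<close>

lemma induced_action_best_reply:
  fixes u :: "'a::finite \<Rightarrow> 'b::finite \<Rightarrow> real"
  assumes p: "p \<in> prob_simplex" and y: "y \<in> prob_simplex" and xs: "\<And>l. xs l \<in> prob_simplex"
    and best: "\<And>l. p $ l \<noteq> 0 \<Longrightarrow> xs l \<in> best_replies u H y"
  shows "induced_action xs p \<in> best_replies u H y"
proof -
  have "worst_payoff u H y x \<le> worst_payoff u H y (induced_action xs p)" if x: "x \<in> prob_simplex" for x
  proof -
    have "p $ l * worst_payoff u H y x \<le> p $ l * worst_payoff u H y (xs l)" for l
    proof (cases "p $ l = 0")
      case False
      then have "worst_payoff u H y x \<le> worst_payoff u H y (xs l)"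
        using best[OF False] x by (auto simp: best_replies_def is_arg_max_def not_less)
      then show ?thesis using p by (intro mult_left_mono) (auto simp: prob_simplex_def)
    qed simp
    then have "(\<Sum>l\<in>UNIV. p $ l * worst_payoff u H y x) \<le> (\<Sum>l\<in>UNIV. p $ l * worst_payoff u H y (xs l))"
      by (intro sum_mono)
    moreover have "(\<Sum>l\<in>UNIV. p $ l * worst_payoff u H y x) = worst_payoff u H y x"
      using p by (simp add: prob_simplex_def flip: sum_distrib_right)
    ultimately show ?thesis using worst_payoff_concave[OF p y, of u H xs] by linarith
  qed
  then show ?thesis
    using induced_action_prob_simplex[OF p xs]
    by (auto simp: best_replies_def is_arg_max_def not_less)
qed

lemma fully_labelled_best_reply:
  fixes u :: "'a::finite \<Rightarrow> 'b::finite \<Rightarrow> real"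
  assumes "best_reply_family u H xs Y" and ys: "\<And>k. ys k \<in> prob_simplex"
    and p: "p \<in> prob_simplex" and q: "q \<in> prob_simplex"
    and lab: "\<And>l. p $ l = 0 \<or> q \<in> lifted_area ys Y l"
  shows "induced_action xs p \<in> best_replies u H (induced_action ys q)"
proof (rule induced_action_best_reply[OF p induced_action_prob_simplex[OF q ys]])
  show "xs l \<in> prob_simplex" for l using assms(1) by (simp add: best_reply_family_def)
  fix l assume "p $ l \<noteq> 0"
  then have "induced_action ys q \<in> Y l" using lab by (auto simp: lifted_area_def)
  \<comment> \<open>\<open>Y l\<close> is one of the polytopes making up the best-reply area of
    \<open>xs l\<close>.\<close>
  moreover have "{y \<in> prob_simplex. xs l \<in> best_replies u H y} = (\<Union>l'\<in>{l'. xs l' = xs l}. Y l')"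
    using assms(1) by (simp add: best_reply_family_def)
  ultimately show "xs l \<in> best_replies u H (induced_action ys q)" by blast
qed

section \<open>Counting fully labelled points\<close>

text \<open>The support of \<open>p\<close> is contained in the labels of \<open>q\<close>, whose
  number genericity bounds by the support of \<open>q\<close>, and the same leads back to the
  support of \<open>p\<close>. So all cardinalities agree and the inclusions are equalities.\<close>

lemma fully_labelled_eq:
  assumes CY: "generic_complex CY" and CX: "generic_complex CX" and "fully_labelled CY CX p q"
  shows "{l. p $ l \<noteq> 0} = {l. q \<in> CY l}" "{k. q $ k \<noteq> 0} = {k. p \<in> CX k}"
    "card {l. p $ l \<noteq> 0} = card {k. q $ k \<noteq> 0}"
proof -
  have sub: "{l. p $ l \<noteq> 0} \<subseteq> {l. q \<in> CY l}" "{k. q $ k \<noteq> 0} \<subseteq> {k. p \<in> CX k}"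
    using assms(3) by (auto simp: fully_labelled_def)
  have "card {l. q \<in> CY l} \<le> card {k. q $ k \<noteq> 0}" "card {k. p \<in> CX k} \<le> card {l. p $ l \<noteq> 0}"
    using assms by (auto simp: fully_labelled_def generic_complex_def)
  moreover have "card {l. p $ l \<noteq> 0} \<le> card {l. q \<in> CY l}" "card {k. q $ k \<noteq> 0} \<le> card {k. p \<in> CX k}"
    using sub by (auto intro: card_mono)
  ultimately have c: "card {l. p $ l \<noteq> 0} = card {l. q \<in> CY l}" "card {k. q $ k \<noteq> 0} = card {k. p \<in> CX k}"
    and "card {l. p $ l \<noteq> 0} = card {k. q $ k \<noteq> 0}"
    by linarith+
  then show "card {l. p $ l \<noteq> 0} = card {k. q $ k \<noteq> 0}" by simp
  show "{l. p $ l \<noteq> 0} = {l. q \<in> CY l}" by (rule card_subset_eq[OF _ sub(1) c(1)]) simp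
  show "{k. q $ k \<noteq> 0} = {k. p \<in> CX k}" by (rule card_subset_eq[OF _ sub(2) c(2)]) simp
qed

text \<open>Taking supports identifies the fully labelled points with the compatible pairs of
  vertices other than \<open>({}, {})\<close>; the number of all compatible pairs is even.\<close>

lemma odd_card_fully_labelled:
  fixes CY :: "'l::finite \<Rightarrow> (real ^ 'k::finite) set" and CX :: "'k \<Rightarrow> (real ^ 'l) set"
  assumes CY: "generic_complex CY" and CX: "generic_complex CX"
  shows "finite {(p, q). fully_labelled CY CX p q}" (is "finite ?F")
    and "odd (card {(p, q). fully_labelled CY CX p q})"
proof -
  define V where "V = {(S, T). vertex CY S T \<and> vertex CX T S}"
  \<comment> \<open>The support of \<open>q\<close> comes first: it plays \<open>S\<close> for
    \<open>CY\<close>, while the support of \<open>p\<close> is the label set of \<open>q\<close>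
    and plays \<open>T\<close>.\<close>
  define supp where "supp = (\<lambda>(p :: real ^ 'l, q :: real ^ 'k). ({k. q $ k \<noteq> 0}, {l. p $ l \<noteq> 0}))"
  have nonempty: "{i. p $ i \<noteq> 0} \<noteq> {}" if "p \<in> prob_simplex" for p :: "real ^ 'n::finite"
  proof
    assume "{i. p $ i \<noteq> 0} = {}"
    then have "(\<Sum>i\<in>UNIV. p $ i) = 0" by (intro sum.neutral) auto
    then show False using that by (simp add: prob_simplex_def)
  qed
  have "bij_betw supp ?F (V - {({}, {})})"
    unfolding bij_betw_def
  proof
    show "inj_on supp ?F"
    proof (rule inj_onI, clarify)
      fix p q p' q'
      assume F: "fully_labelled CY CX p q" "fully_labelled CY CX p' q'"
        and eq: "supp (p, q) = supp (p', q')"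
      note L = fully_labelled_eq[OF CY CX F(1)] and L' = fully_labelled_eq[OF CY CX F(2)]
      have "q = q'"
        by (rule vertex_unique[OF CY]) (use F L L' eq in \<open>auto simp: fully_labelled_def supp_def\<close>)
      moreover have "p = p'"
        by (rule vertex_unique[OF CX]) (use F L L' eq in \<open>auto simp: fully_labelled_def supp_def\<close>)
      ultimately show "p = p' \<and> q = q'" by simp
    qed
    show "supp ` ?F = V - {({}, {})}"
    proof (intro subset_antisym subsetI)
      fix x assume "x \<in> supp ` ?F"
      then obtain p q where F: "fully_labelled CY CX p q" and x: "x = supp (p, q)" by auto
      have simplex: "p \<in> prob_simplex" "q \<in> prob_simplex" using F by (auto simp: fully_labelled_def)
      note L = fully_labelled_eq[OF CY CX F]
      have "vertex CY {k. q $ k \<noteq> 0} {l. p $ l \<noteq> 0}"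
        unfolding vertex_def
        by (intro conjI disjI2 bexI[of _ q]) (rule L(3)[symmetric] refl L(1)[symmetric] simplex)+
      moreover have "vertex CX {l. p $ l \<noteq> 0} {k. q $ k \<noteq> 0}"
        unfolding vertex_def
        by (intro conjI disjI2 bexI[of _ p]) (rule L(3) refl L(2)[symmetric] simplex)+
      ultimately show "x \<in> V - {({}, {})}"
        using nonempty[OF simplex(1)] by (simp add: V_def supp_def x)
    next
      fix x assume "x \<in> V - {({}, {})}"
      then obtain S T where ST: "x = (S, T)" "vertex CY S T" "vertex CX T S" "S \<noteq> {} \<or> T \<noteq> {}"
        by (auto simp: V_def)
      \<comment> \<open>Equal cardinality makes one set empty only together with the other.\<close>
      then have "S \<noteq> {}" "T \<noteq> {}" by (auto simp: vertex_def)
      then obtain p q where "q \<in> prob_simplex" "{k. q $ k \<noteq> 0} = S" "{l. q \<in> CY l} = T"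
        "p \<in> prob_simplex" "{l. p $ l \<noteq> 0} = T" "{k. p \<in> CX k} = S"
        using ST(2,3) unfolding vertex_def by blast
      then have "fully_labelled CY CX p q" "supp (p, q) = x"
        using ST(1) by (auto simp: fully_labelled_def supp_def)
      then show "x \<in> supp ` ?F" by force
    qed
  qed
  then show "finite ?F" and "odd (card ?F)"
  proof -
    assume bij: "bij_betw supp ?F (V - {({}, {})})"
    have "finite V" by simp
    then show "finite ?F" using bij_betw_finite[OF bij] by simp
    have "even (card V)"
      unfolding V_def
      by (rule even_card_compatible_pairs) (rule even_vertices_complex[OF CY], rule even_vertices_complex[OF CX])
    moreover have "({}, {}) \<in> V" by (simp add: V_def vertex_def)
    ultimately show "odd (card ?F)"
      using bij_betw_same_card[OF bij] card_Suc_Diff1[OF \<open>finite V\<close>, of "({}, {})"]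
      by (metis even_Suc)
  qed
qed

theorem mainTheorem5:
  fixes u v :: "'a::finite \<Rightarrow> 'b::finite \<Rightarrow> real"
    and \<H> :: "'h::{real_vector, topological_space} set"
    and \<M> :: "'m::{real_vector, topological_space} set"
    and H :: "'a \<Rightarrow> 'b \<Rightarrow> 'h" and M :: "'a \<Rightarrow> 'b \<Rightarrow> 'm"
    and xs :: "'l::finite \<Rightarrow> real ^ 'a" and ys :: "'k::finite \<Rightarrow> real ^ 'b"
    and Y :: "'l \<Rightarrow> (real ^ 'b) set" and X :: "'k \<Rightarrow> (real ^ 'a) set"
  assumes "convex \<H>" and "compact \<H>" and "\<And>a b. H a b \<in> \<H>"
    and "convex \<M>" and "compact \<M>" and "\<And>a b. M a b \<in> \<M>"
    and "best_reply_family u H xs Y"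
    and "best_reply_family (\<lambda>b a. v a b) (\<lambda>b a. M a b) ys X"
    and "generic_complex (lifted_area ys Y)"
    and "generic_complex (lifted_area xs X)"
  shows "finite {(p, q). fully_labelled (lifted_area ys Y) (lifted_area xs X) p q} \<and>
    odd (card {(p, q). fully_labelled (lifted_area ys Y) (lifted_area xs X) p q}) \<and>
    (\<forall>p q. fully_labelled (lifted_area ys Y) (lifted_area xs X) p q \<longrightarrow>
       nash_equilibrium u v H M (induced_action xs p) (induced_action ys q))"
proof (intro conjI allI impI)
  show "finite {(p, q). fully_labelled (lifted_area ys Y) (lifted_area xs X) p q}"
    and "odd (card {(p, q). fully_labelled (lifted_area ys Y) (lifted_area xs X) p q})"
    by (fact odd_card_fully_labelled[OF assms(9,10)])+
next
  fix p q assume F: "fully_labelled (lifted_area ys Y) (lifted_area xs X) p q"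
  have "xs l \<in> prob_simplex" "ys k \<in> prob_simplex" for l k
    using assms(7,8) by (simp_all add: best_reply_family_def)
  then show "nash_equilibrium u v H M (induced_action xs p) (induced_action ys q)"
    using F fully_labelled_best_reply[OF assms(7), of ys p q] fully_labelled_best_reply[OF assms(8), of xs q p]
    by (simp add: nash_equilibrium_def fully_labelled_def induced_action_prob_simplex)
qed

end
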